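(* Let $n\ge 2$, let $(X^{n+1},g)$ be a hyperbolic Poincaré manifold with conformal infinity $(M^n,[\hat g])$, let $\gamma\in[\hat g]$ be a representative of the conformal infinity, and let $r$ be the geodesic defining function associated with $\gamma$, so that near $M$ one has $g=r^{-2}(dr^2+g_r)$ with $g_r=\gamma-r^2P_\gamma+\frac{r^4}{4}Q(P_\gamma)$. Then the eigenvalues $\lambda_1,\dots,\lambda_n$ (with respect to $\gamma$) of the tensor $P_\gamma$ satisfy $$1-\frac{r^2}{2}\lambda_i=\frac{2}{1-\kappa_i},\qquad i=1,\dots,n,$$ where $\kappa_i=\kappa_i(r)$ denotes the $i$-th outward principal curvature of the level sets of $r$ (at the point of the level set corresponding to $x\in M$ under the product structure induced by $r$, with $\lambda_i=\lambda_i(x)$ and the $\kappa_i$ suitably indexed).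
   Context: Let $X^{n+1}$ be the interior of a smooth compact manifold $\bar X^{n+1}$ with boundary $\partial X=M^n$. A defining function for $M$ is a smooth function $r:\bar X\to\mathbb{R}$ with $r>0$ in $X$, $r=0$ on $M$, and $dr\ne 0$ on $M$. A Riemannian metric $g$ on $X$ is conformally compact if for a defining function $r$ the metric $\bar g=r^2g$ extends to a metric on $\bar X$. The restriction of $\bar g$ to $TM$ is a metric $\hat g$ on $M$, whose conformal class $[\hat g]$ is independent of the defining function; $(M,[\hat g])$ is the conformal infinity of $(X,g)$. A hyperbolic Poincaré manifold is a conformally compact hyperbolic manifold, i.e. $(X,g)$ is conformally compact, complete, with constant sectional curvature $-1$ (a quotient of hyperbolic space $\mathbb{H}^{n+1}$ by a discrete group of isometries). Geodesic defining function: each representative $\gamma\in[\hat g]$ determines a unique (near $M$) defining function $r$ such that $r^2g$ extends to a metric on $\bar X$, $r^2g|_{TM}=\gamma$, and $|dr|^2_{r^2g}\equiv 1$ in a neighborhood of $M$ in $\bar X$. It induces (by the flow of the $r^2g$-gradient $\partial_r$ of $r$) a product structure $M\times[0,\epsilon)$ near $M$ in which $g=r^{-2}(dr^2+g_r)$ with $g_r$ a one-parameter family of metrics on $M$. For a hyperbolic Poincaré manifold it is known (Fefferman–Graham) that $$g_r=\gamma-r^2P_\gamma+\frac{r^4}{4}Q(P_\gamma),\qquad Q(P_\gamma)_{ij}=\gamma^{kl}(P_\gamma)_{ik}(P_\gamma)_{jl}.$$ For $n\ge 3$, $P_\gamma=\frac{1}{n-2}\left(Ric_\gamma-\frac{R_\gamma}{2(n-1)}\gamma\right)$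 is the Schouten tensor of $\gamma$, where $Ric_\gamma$ and $R_\gamma$ are the Ricci and scalar curvature. For $n=2$, $P_\gamma$ is the symmetric $2$-tensor on $M$ appearing in this expansion (minus the coefficient of $r^2$ in $g_r$); it satisfies $\gamma^{ij}(P_\gamma)_{ij}=\frac{R_\gamma}{2}$. Sign convention: the second fundamental form of a hypersurface with chosen unit normal $N$ is $II=-\frac12\mathcal{L}_Ng$ ($\mathcal L$ the Lie derivative), so that a unit sphere in Euclidean space with inward normal has principal curvatures $1$. Outward principal curvatures of the level sets of $r$ are the eigenvalues of $II$ relative to the induced metric, for the outward unit normal $N_r=-r\,\partial_r$ (pointing toward $M$). The quantity $\frac{2}{1-\kappa_i}$ is called the $i$-th hyperbolic principal curvature radius. The level sets considered are those with $r>0$ in the neighborhood of $M$ where the normal form holds. *)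

theory Defs
  imports "HOL-Analysis.Analysis"
begin

section \<open>Smooth maps between Euclidean spaces\<close>

text \<open>Meant for open \<open>S\<close>: \<open>f\<close> is \<open>k\<close> times continuously differentiable on \<open>S\<close>.\<close>

fun Ck_on :: "nat \<Rightarrow> 'a::euclidean_space set \<Rightarrow> ('a \<Rightarrow> 'b::real_normed_vector) \<Rightarrow> bool" where
  "Ck_on 0 S f \<longleftrightarrow> continuous_on S f"
| "Ck_on (Suc k) S f \<longleftrightarrow>
     (\<forall>x\<in>S. f differentiable (at x)) \<and>
     (\<forall>b\<in>Basis. Ck_on k S (\<lambda>x. frechet_derivative f (at x) b))"

text \<open>For arbitrary \<open>S\<close> (for instance relatively open subsets of a half space), smoothness
  means that \<open>f\<close> is locally the restriction of a smooth function on an open set.\<close>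

definition smooth_on :: "'a::euclidean_space set \<Rightarrow> ('a \<Rightarrow> 'b::real_normed_vector) \<Rightarrow> bool" where
  "smooth_on S f \<longleftrightarrow>
     (\<forall>x\<in>S. \<exists>U h. open U \<and> x \<in> U \<and> (\<forall>k. Ck_on k U h) \<and> (\<forall>y\<in>U \<inter> S. h y = f y))"


section \<open>Compact manifolds with boundary\<close>

text \<open>A chart is a pair of its domain and its coordinate map; only the values of the
  coordinate map on the domain matter.\<close>

type_synonym ('a, 'e) chart = "'a set \<times> ('a \<Rightarrow> 'e)"

definition chart_inv :: "('a, 'e) chart \<Rightarrow> 'e \<Rightarrow> 'a" where
  "chart_inv c = inv_into (fst c) (snd c)"

definition is_chart :: "'e::euclidean_space set \<Rightarrow> 'a topology \<Rightarrow> ('a, 'e) chart \<Rightarrow> bool" where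
  "is_chart H T c \<longleftrightarrow>
     openin T (fst c) \<and> openin (top_of_set H) (snd c ` fst c) \<and>
     homeomorphic_map (subtopology T (fst c)) (top_of_set (snd c ` fst c)) (snd c)"

text \<open>A (not necessarily maximal) smooth atlas of \<open>T\<close> modelled on \<open>H\<close>.\<close>

definition smooth_atlas ::
    "'e::euclidean_space set \<Rightarrow> 'a topology \<Rightarrow> ('a, 'e) chart set \<Rightarrow> bool" where
  "smooth_atlas H T A \<longleftrightarrow>
     (\<forall>c\<in>A. is_chart H T c) \<and> (\<Union>c\<in>A. fst c) = topspace T \<and>
     (\<forall>c\<in>A. \<forall>d\<in>A. smooth_on (snd c ` (fst c \<inter> fst d)) (snd d \<circ> chart_inv c))"

definition halfspace :: "(real \<times> 'e::euclidean_space) set" where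
  "halfspace = {z. 0 \<le> fst z}"

text \<open>The dimension of the manifold is \<open>n + 1\<close> for \<open>n = DIM('e)\<close>.\<close>

definition compact_manifold_with_boundary ::
    "'a topology \<Rightarrow> ('a, real \<times> 'e::euclidean_space) chart set \<Rightarrow> bool" where
  "compact_manifold_with_boundary T A \<longleftrightarrow>
     compact_space T \<and> Hausdorff_space T \<and> second_countable T \<and> smooth_atlas halfspace T A"

definition mbdry :: "('a, real \<times> 'e::euclidean_space) chart set \<Rightarrow> 'a set" where
  "mbdry A = {p. \<exists>c\<in>A. p \<in> fst c \<and> fst (snd c p) = 0}"

definition mint :: "'a topology \<Rightarrow> ('a, real \<times> 'e::euclidean_space) chart set \<Rightarrow> 'a set" where
  "mint T A = topspace T - mbdry A"

text \<open>The atlas, modelled on \<open>'e\<close>, induced on the boundary.\<close>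

definition bchart ::
    "('a, real \<times> 'e::euclidean_space) chart set \<Rightarrow> ('a, real \<times> 'e) chart \<Rightarrow> ('a, 'e) chart" where
  "bchart A c = (fst c \<inter> mbdry A, snd \<circ> snd c)"

definition batlas :: "('a, real \<times> 'e::euclidean_space) chart set \<Rightarrow> ('a, 'e) chart set" where
  "batlas A = bchart A ` A"


section \<open>Functions and covariant 2-tensors on manifolds\<close>

definition smooth_fun :: "('a, 'e::euclidean_space) chart set \<Rightarrow> 'a set \<Rightarrow> ('a \<Rightarrow> real) \<Rightarrow> bool" where
  "smooth_fun A S f \<longleftrightarrow> (\<forall>c\<in>A. smooth_on (snd c ` (fst c \<inter> S)) (f \<circ> chart_inv c))"

definition dif :: "('a, 'e::euclidean_space) chart \<Rightarrow> ('a \<Rightarrow> real) \<Rightarrow> 'a \<Rightarrow> 'e \<Rightarrow> real" where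
  "dif c f p = frechet_derivative (f \<circ> chart_inv c) (at (snd c p) within snd c ` fst c)"

text \<open>A covariant 2-tensor is given by its expressions in the charts: \<open>h c p u v\<close> is the value at
  the point \<open>p\<close> on the tangent vectors with coordinates \<open>u\<close> and \<open>v\<close> in the chart \<open>c\<close>.\<close>

type_synonym ('a, 'e) tensor2 = "('a, 'e) chart \<Rightarrow> 'a \<Rightarrow> 'e \<Rightarrow> 'e \<Rightarrow> real"

definition tensor2_on ::
    "('a, 'e::euclidean_space) chart set \<Rightarrow> 'a set \<Rightarrow> ('a, 'e) tensor2 \<Rightarrow> bool" where
  "tensor2_on A S h \<longleftrightarrow>
     (\<forall>c\<in>A. \<forall>p\<in>fst c \<inter> S. bilinear (h c p)) \<and>
     (\<forall>c\<in>A. \<forall>d\<in>A. \<forall>p\<in>fst c \<inter> fst d \<inter> S. \<forall>D.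
        ((snd d \<circ> chart_inv c) has_derivative D)
          (at (snd c p) within snd c ` (fst c \<inter> fst d)) \<longrightarrow>
        (\<forall>u v. h c p u v = h d p (D u) (D v))) \<and>
     (\<forall>c\<in>A. \<forall>u v. smooth_on (snd c ` (fst c \<inter> S)) (\<lambda>y. h c (chart_inv c y) u v))"

definition sym_tensor2_on ::
    "('a, 'e::euclidean_space) chart set \<Rightarrow> 'a set \<Rightarrow> ('a, 'e) tensor2 \<Rightarrow> bool" where
  "sym_tensor2_on A S h \<longleftrightarrow>
     tensor2_on A S h \<and> (\<forall>c\<in>A. \<forall>p\<in>fst c \<inter> S. \<forall>u v. h c p u v = h c p v u)"

definition riemannian_metric ::
    "('a, 'e::euclidean_space) chart set \<Rightarrow> 'a set \<Rightarrow> ('a, 'e) tensor2 \<Rightarrow> bool" where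
  "riemannian_metric A S g \<longleftrightarrow>
     sym_tensor2_on A S g \<and> (\<forall>c\<in>A. \<forall>p\<in>fst c \<inter> S. \<forall>u. u \<noteq> 0 \<longrightarrow> g c p u u > 0)"

definition coord_rep ::
    "('a, 'e) chart \<Rightarrow> ('a, 'e) tensor2 \<Rightarrow> 'e \<Rightarrow> 'e \<Rightarrow> 'e \<Rightarrow> real" where
  "coord_rep c h y = h c (chart_inv c y)"

text \<open>The vector dual to the covector \<open>\<alpha>\<close> with respect to the inner product \<open>G\<close>.\<close>

definition raise :: "('e \<Rightarrow> 'e \<Rightarrow> real) \<Rightarrow> ('e \<Rightarrow> real) \<Rightarrow> 'e" where
  "raise G \<alpha> = (THE w. \<forall>z. G w z = \<alpha> z)"

definition gradient ::
    "('a, 'e::euclidean_space) tensor2 \<Rightarrow> ('a \<Rightarrow> real) \<Rightarrow> ('a, 'e) chart \<Rightarrow> 'a \<Rightarrow> 'e" where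
  "gradient g f c p = raise (g c p) (dif c f p)"


section \<open>Curvature in coordinates\<close>

text \<open>Here \<open>G y u v\<close> is a metric on an open set of \<open>'e\<close>, in coordinates. The Christoffel symbols
  are given as the bilinear map \<open>\<Gamma>(u,v) = \<Gamma>\<^sup>k\<^sub>i\<^sub>j u\<^sup>i v\<^sup>j\<close>.\<close>

definition christoffel ::
    "('e::euclidean_space \<Rightarrow> 'e \<Rightarrow> 'e \<Rightarrow> real) \<Rightarrow> 'e \<Rightarrow> 'e \<Rightarrow> 'e \<Rightarrow> 'e" where
  "christoffel G y u v = raise (G y) (\<lambda>z.
     (frechet_derivative (\<lambda>x. G x v z) (at y) u
      + frechet_derivative (\<lambda>x. G x u z) (at y) v
      - frechet_derivative (\<lambda>x. G x u v) (at y) z) / 2)"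

text \<open>\<open>R(u,v)w = \<nabla>\<^sub>u\<nabla>\<^sub>vw - \<nabla>\<^sub>v\<nabla>\<^sub>uw\<close> for constant coordinate fields.\<close>

definition curvature ::
    "('e::euclidean_space \<Rightarrow> 'e \<Rightarrow> 'e \<Rightarrow> real) \<Rightarrow> 'e \<Rightarrow> 'e \<Rightarrow> 'e \<Rightarrow> 'e \<Rightarrow> 'e" where
  "curvature G y u v w =
     frechet_derivative (\<lambda>x. christoffel G x v w) (at y) u
     - frechet_derivative (\<lambda>x. christoffel G x u w) (at y) v
     + christoffel G y u (christoffel G y v w) - christoffel G y v (christoffel G y u w)"

definition sectional ::
    "('e::euclidean_space \<Rightarrow> 'e \<Rightarrow> 'e \<Rightarrow> real) \<Rightarrow> 'e \<Rightarrow> 'e \<Rightarrow> 'e \<Rightarrow> real" where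
  "sectional G y u v =
     G y (curvature G y u v v) u / (G y u u * G y v v - (G y u v)\<^sup>2)"

definition ricci ::
    "('e::euclidean_space \<Rightarrow> 'e \<Rightarrow> 'e \<Rightarrow> real) \<Rightarrow> 'e \<Rightarrow> 'e \<Rightarrow> 'e \<Rightarrow> real" where
  "ricci G y v w = (\<Sum>b\<in>Basis. curvature G y b v w \<bullet> b)"

text \<open>\<open>G\<^sup>i\<^sup>j B\<^sub>i\<^sub>j\<close>\<close>

definition metric_trace ::
    "('e::euclidean_space \<Rightarrow> 'e \<Rightarrow> real) \<Rightarrow> ('e \<Rightarrow> 'e \<Rightarrow> real) \<Rightarrow> real" where
  "metric_trace G B = (\<Sum>b\<in>Basis. raise G (B b) \<bullet> b)"

definition scalar_curv ::
    "('e::euclidean_space \<Rightarrow> 'e \<Rightarrow> 'e \<Rightarrow> real) \<Rightarrow> 'e \<Rightarrow> real" where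
  "scalar_curv G y = metric_trace (G y) (ricci G y)"

definition schouten ::
    "('e::euclidean_space \<Rightarrow> 'e \<Rightarrow> 'e \<Rightarrow> real) \<Rightarrow> 'e \<Rightarrow> 'e \<Rightarrow> 'e \<Rightarrow> real" where
  "schouten G y u v =
     (ricci G y u v - scalar_curv G y / (2 * (real DIM('e) - 1)) * G y u v) / (real DIM('e) - 2)"

text \<open>\<open>Q(P)\<^sub>i\<^sub>j = \<gamma>\<^sup>k\<^sup>l P\<^sub>i\<^sub>k P\<^sub>j\<^sub>l\<close>\<close>

definition Q_tensor ::
    "('a, 'e::euclidean_space) tensor2 \<Rightarrow> ('a, 'e) tensor2 \<Rightarrow> ('a, 'e) tensor2" where
  "Q_tensor \<gamma> P d x u v = P d x u (raise (\<gamma> d x) (P d x v))"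


section \<open>Completeness\<close>

definition smooth_curve ::
    "'a topology \<Rightarrow> ('a, 'e::euclidean_space) chart set \<Rightarrow> 'a set \<Rightarrow> (real \<Rightarrow> 'a) \<Rightarrow> bool" where
  "smooth_curve T A S \<sigma> \<longleftrightarrow>
     continuous_map (top_of_set {0..1}) (subtopology T S) \<sigma> \<and>
     (\<forall>c\<in>A. smooth_on {t\<in>{0..1}. \<sigma> t \<in> fst c} (snd c \<circ> \<sigma>))"

text \<open>The norm of the velocity does not depend on the chart.\<close>

definition speed ::
    "('a, 'e::euclidean_space) chart set \<Rightarrow> ('a, 'e) tensor2 \<Rightarrow> (real \<Rightarrow> 'a) \<Rightarrow> real \<Rightarrow> real" where
  "speed A g \<sigma> t = (THE s. \<forall>c\<in>A. \<sigma> t \<in> fst c \<longrightarrow>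
     (let v = vector_derivative (snd c \<circ> \<sigma>) (at t within {0..1}) in s = sqrt (g c (\<sigma> t) v v)))"

definition riem_dist ::
    "'a topology \<Rightarrow> ('a, 'e::euclidean_space) chart set \<Rightarrow> 'a set \<Rightarrow> ('a, 'e) tensor2 \<Rightarrow>
     'a \<Rightarrow> 'a \<Rightarrow> ennreal" where
  "riem_dist T A S g p q =
     (INF \<sigma>\<in>{\<sigma>. smooth_curve T A S \<sigma> \<and> \<sigma> 0 = p \<and> \<sigma> 1 = q}. ennreal (integral {0..1} (speed A g \<sigma>)))"

definition complete_metric ::
    "'a topology \<Rightarrow> ('a, 'e::euclidean_space) chart set \<Rightarrow> 'a set \<Rightarrow> ('a, 'e) tensor2 \<Rightarrow> bool" where
  "complete_metric T A S g \<longleftrightarrow>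
     (\<forall>x :: nat \<Rightarrow> 'a. range x \<subseteq> S \<and>
        (\<forall>e>0. \<exists>N. \<forall>m\<ge>N. \<forall>k\<ge>N. riem_dist T A S g (x m) (x k) < e) \<longrightarrow>
        (\<exists>l\<in>S. limitin (subtopology T S) x l sequentially))"


section \<open>Conformally compact and hyperbolic Poincare manifolds\<close>

definition defining_function ::
    "'a topology \<Rightarrow> ('a, real \<times> 'e::euclidean_space) chart set \<Rightarrow> ('a \<Rightarrow> real) \<Rightarrow> bool" where
  "defining_function T A r \<longleftrightarrow>
     smooth_fun A (topspace T) r \<and> (\<forall>p\<in>mint T A. r p > 0) \<and> (\<forall>p\<in>mbdry A. r p = 0) \<and>
     (\<forall>c\<in>A. \<forall>p\<in>fst c \<inter> mbdry A. \<exists>v. dif c r p v \<noteq> 0)"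

text \<open>\<open>gbar\<close> is an extension of \<open>r\<^sup>2 g\<close> to a metric on the whole compact manifold.\<close>

definition compactification ::
    "'a topology \<Rightarrow> ('a, real \<times> 'e::euclidean_space) chart set \<Rightarrow> ('a, real \<times> 'e) tensor2 \<Rightarrow>
     ('a \<Rightarrow> real) \<Rightarrow> ('a, real \<times> 'e) tensor2 \<Rightarrow> bool" where
  "compactification T A g r gbar \<longleftrightarrow>
     defining_function T A r \<and> riemannian_metric A (topspace T) gbar \<and>
     (\<forall>c\<in>A. \<forall>p\<in>fst c \<inter> mint T A. \<forall>u v. gbar c p u v = (r p)\<^sup>2 * g c p u v)"

definition conformally_compact ::
    "'a topology \<Rightarrow> ('a, real \<times> 'e::euclidean_space) chart set \<Rightarrow> ('a, real \<times> 'e) tensor2 \<Rightarrow> bool" where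
  "conformally_compact T A g \<longleftrightarrow>
     riemannian_metric A (mint T A) g \<and> (\<exists>r gbar. compactification T A g r gbar)"

text \<open>\<open>\<phi> gbar|\<^sub>T\<^sub>M = \<gamma>\<close> for a function \<open>\<phi>\<close> on \<open>M\<close>; vectors tangent to the boundary have
  coordinates \<open>(0, u)\<close>.\<close>

definition restricts_to ::
    "('a, real \<times> 'e::euclidean_space) chart set \<Rightarrow> ('a \<Rightarrow> real) \<Rightarrow> ('a, real \<times> 'e) tensor2 \<Rightarrow>
     ('a, 'e) tensor2 \<Rightarrow> bool" where
  "restricts_to A \<phi> gbar \<gamma> \<longleftrightarrow>
     (\<forall>c\<in>A. \<forall>p\<in>fst c \<inter> mbdry A. \<forall>u v.
        \<gamma> (bchart A c) p u v = \<phi> p * gbar c p (0, u) (0, v))"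

definition conformal_infinity ::
    "'a topology \<Rightarrow> ('a, real \<times> 'e::euclidean_space) chart set \<Rightarrow> ('a, real \<times> 'e) tensor2 \<Rightarrow>
     ('a, 'e) tensor2 set" where
  "conformal_infinity T A g =
     {\<gamma>. riemannian_metric (batlas A) (mbdry A) \<gamma> \<and>
        (\<exists>r gbar \<phi>. compactification T A g r gbar \<and>
           smooth_fun (batlas A) (mbdry A) \<phi> \<and> (\<forall>p\<in>mbdry A. \<phi> p > 0) \<and>
           restricts_to A \<phi> gbar \<gamma>)}"

definition hyperbolic_poincare ::
    "'a topology \<Rightarrow> ('a, real \<times> 'e::euclidean_space) chart set \<Rightarrow> ('a, real \<times> 'e) tensor2 \<Rightarrow> bool" where
  "hyperbolic_poincare T A g \<longleftrightarrow>
     compact_manifold_with_boundary T A \<and> conformally_compact T A g \<and>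
     complete_metric T A (mint T A) g \<and>
     (\<forall>c\<in>A. \<forall>p\<in>fst c \<inter> mint T A. \<forall>u v. u \<noteq> v \<and> independent {u, v} \<longrightarrow>
        sectional (coord_rep c g) (snd c p) u v = -1)"


section \<open>Geodesic defining functions and the normal form\<close>

definition geodesic_defining_function ::
    "'a topology \<Rightarrow> ('a, real \<times> 'e::euclidean_space) chart set \<Rightarrow> ('a, real \<times> 'e) tensor2 \<Rightarrow>
     ('a, 'e) tensor2 \<Rightarrow> ('a \<Rightarrow> real) \<Rightarrow> ('a, real \<times> 'e) tensor2 \<Rightarrow> bool" where
  "geodesic_defining_function T A g \<gamma> r gbar \<longleftrightarrow>
     compactification T A g r gbar \<and> restricts_to A (\<lambda>_. 1) gbar \<gamma> \<and>
     (\<exists>V. openin T V \<and> mbdry A \<subseteq> V \<and>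
        (\<forall>c\<in>A. \<forall>p\<in>fst c \<inter> V. gbar c p (gradient gbar r c p) (gradient gbar r c p) = 1))"

text \<open>\<open>\<Phi> : M \<times> [0,\<epsilon>) \<rightarrow> X\<close> is the diffeomorphism onto a neighbourhood of \<open>M\<close> given by the flow of
  the gradient of \<open>r\<close>, with second component \<open>r\<close>.\<close>

definition product_structure ::
    "'a topology \<Rightarrow> ('a, real \<times> 'e::euclidean_space) chart set \<Rightarrow> ('a, real \<times> 'e) tensor2 \<Rightarrow>
     ('a \<Rightarrow> real) \<Rightarrow> real \<Rightarrow> ('a \<times> real \<Rightarrow> 'a) \<Rightarrow> bool" where
  "product_structure T A gbar r \<epsilon> \<Phi> \<longleftrightarrow>
     (let M = mbdry A; W = \<Phi> ` (M \<times> {0..<\<epsilon>}) in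
       \<epsilon> > 0 \<and> openin T W \<and>
       homeomorphic_map (prod_topology (subtopology T M) (top_of_set {0..<\<epsilon>}))
         (subtopology T W) \<Phi> \<and>
       (\<forall>c\<in>A. \<forall>d\<in>batlas A.
          smooth_on {(t, y). t \<in> {0..<\<epsilon>} \<and> y \<in> snd d ` fst d \<and> \<Phi> (chart_inv d y, t) \<in> fst c}
            (\<lambda>(t, y). snd c (\<Phi> (chart_inv d y, t))) \<and>
          smooth_on (snd c ` (fst c \<inter> \<Phi> ` (fst d \<times> {0..<\<epsilon>})))
            (\<lambda>z. let (x, t) = inv_into (M \<times> {0..<\<epsilon>}) \<Phi> (chart_inv c z) in (t, snd d x))) \<and>
       (\<forall>x\<in>M. \<Phi> (x, 0) = x) \<and>
       (\<forall>x\<in>M. \<forall>t\<in>{0..<\<epsilon>}. r (\<Phi> (x, t)) = t) \<and>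
       (\<forall>x\<in>M. \<forall>t\<in>{0..<\<epsilon>}. \<forall>c\<in>A. \<Phi> (x, t) \<in> fst c \<longrightarrow>
          ((\<lambda>s. snd c (\<Phi> (x, s))) has_vector_derivative gradient gbar r c (\<Phi> (x, t)))
            (at t within {0..<\<epsilon>})))"

text \<open>\<open>g = r\<^sup>-\<^sup>2 (dr\<^sup>2 + h\<^sub>r)\<close> in the product structure \<open>\<Phi>\<close>: here \<open>D\<close> is the differential of \<open>\<Phi>\<close>
  expressed in the chart \<open>c\<close> and in \<open>r\<close> together with the chart \<open>d\<close> of \<open>M\<close>, and \<open>a\<close>, \<open>b\<close> are
  \<open>\<partial>\<^sub>r\<close>-components.\<close>

definition normal_form ::
    "'a topology \<Rightarrow> ('a, real \<times> 'e::euclidean_space) chart set \<Rightarrow> ('a, real \<times> 'e) tensor2 \<Rightarrow>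
     real \<Rightarrow> ('a \<times> real \<Rightarrow> 'a) \<Rightarrow> (real \<Rightarrow> ('a, 'e) tensor2) \<Rightarrow> bool" where
  "normal_form T A g \<epsilon> \<Phi> h \<longleftrightarrow>
     (\<forall>c\<in>A. \<forall>d\<in>batlas A. \<forall>x\<in>fst d. \<forall>t\<in>{0<..<\<epsilon>}. \<forall>D. \<Phi> (x, t) \<in> fst c \<and>
        ((\<lambda>(s, y). snd c (\<Phi> (chart_inv d y, s))) has_derivative D)
          (at (t, snd d x) within {0<..<\<epsilon>} \<times> snd d ` fst d) \<longrightarrow>
        (\<forall>a b u v. g c (\<Phi> (x, t)) (D (a, u)) (D (b, v)) = (a * b + h t d x u v) / t\<^sup>2))"

definition FG_family ::
    "('a, 'e::euclidean_space) tensor2 \<Rightarrow> ('a, 'e) tensor2 \<Rightarrow> real \<Rightarrow> ('a, 'e) tensor2" where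
  "FG_family \<gamma> P t d x u v =
     \<gamma> d x u v - t\<^sup>2 * P d x u v + t ^ 4 / 4 * Q_tensor \<gamma> P d x u v"

text \<open>\<open>P\<close> is the tensor \<open>P\<^sub>\<gamma>\<close>: a symmetric 2-tensor on \<open>M\<close>, minus the coefficient of \<open>r\<^sup>2\<close> in the
  expansion of the normal form, which is the Schouten tensor of \<open>\<gamma>\<close> when \<open>n \<ge> 3\<close>.\<close>

definition FG_expansion ::
    "'a topology \<Rightarrow> ('a, real \<times> 'e::euclidean_space) chart set \<Rightarrow> ('a, real \<times> 'e) tensor2 \<Rightarrow>
     ('a, 'e) tensor2 \<Rightarrow> real \<Rightarrow> ('a \<times> real \<Rightarrow> 'a) \<Rightarrow> ('a, 'e) tensor2 \<Rightarrow> bool" where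
  "FG_expansion T A g \<gamma> \<epsilon> \<Phi> P \<longleftrightarrow>
     sym_tensor2_on (batlas A) (mbdry A) P \<and>
     (DIM('e) \<ge> 3 \<longrightarrow>
        (\<forall>d\<in>batlas A. \<forall>x\<in>fst d. P d x = schouten (coord_rep d \<gamma>) (snd d x))) \<and>
     normal_form T A g \<epsilon> \<Phi> (FG_family \<gamma> P)"


section \<open>Eigenvalues and principal curvatures\<close>

text \<open>\<open>\<mu> 1, \<dots>, \<mu> k\<close> are the eigenvalues, repeated according to multiplicity, of the symmetric
  bilinear form \<open>B\<close> relative to the inner product \<open>G\<close> on the \<open>k\<close>-dimensional subspace \<open>V\<close>.\<close>

definition eigenvalues_of ::
    "nat \<Rightarrow> 'e::euclidean_space set \<Rightarrow> ('e \<Rightarrow> 'e \<Rightarrow> real) \<Rightarrow> ('e \<Rightarrow> 'e \<Rightarrow> real) \<Rightarrow>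
     (nat \<Rightarrow> real) \<Rightarrow> bool" where
  "eigenvalues_of k V G B \<mu> \<longleftrightarrow>
     (\<forall>a. card {i\<in>{1..k}. \<mu> i = a} = dim {v\<in>V. \<forall>w\<in>V. B v w = a * G v w})"

definition tensor_eigenvalues ::
    "('a, 'e::euclidean_space) chart set \<Rightarrow> ('a, 'e) tensor2 \<Rightarrow> ('a, 'e) tensor2 \<Rightarrow> 'a \<Rightarrow>
     (nat \<Rightarrow> real) \<Rightarrow> bool" where
  "tensor_eigenvalues B \<gamma> P x \<mu> \<longleftrightarrow>
     (\<forall>d\<in>B. x \<in> fst d \<longrightarrow> eigenvalues_of DIM('e) UNIV (\<gamma> d x) (P d x) \<mu>)"

text \<open>In coordinates, \<open>(\<L>\<^sub>N G)(u,v) = (D\<^sub>N G)(u,v) + G(D\<^sub>u N, v) + G(u, D\<^sub>v N)\<close>.\<close>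

definition lie_derivative ::
    "('e::euclidean_space \<Rightarrow> 'e) \<Rightarrow> ('e \<Rightarrow> 'e \<Rightarrow> 'e \<Rightarrow> real) \<Rightarrow> 'e \<Rightarrow> 'e \<Rightarrow> 'e \<Rightarrow> real" where
  "lie_derivative N G y u v =
     frechet_derivative (\<lambda>x. G x u v) (at y) (N y)
     + G y (frechet_derivative N (at y) u) v + G y u (frechet_derivative N (at y) v)"

text \<open>\<open>II = - \<L>\<^sub>N g / 2\<close>, evaluated on vectors at \<open>p\<close>; \<open>N\<close> is given by its expressions in charts.\<close>

definition second_ff ::
    "('a, 'e::euclidean_space) tensor2 \<Rightarrow> (('a, 'e) chart \<Rightarrow> 'a \<Rightarrow> 'e) \<Rightarrow> ('a, 'e) tensor2" where
  "second_ff g N c p u v =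
     - (1/2) * lie_derivative (\<lambda>y. N c (chart_inv c y)) (coord_rep c g) (snd c p) u v"

text \<open>\<open>N\<^sub>r = - r \<partial>\<^sub>r\<close>, where \<open>\<partial>\<^sub>r\<close> is the gradient of \<open>r\<close> with respect to \<open>gbar\<close>.\<close>

definition outward_normal ::
    "('a, 'e::euclidean_space) tensor2 \<Rightarrow> ('a \<Rightarrow> real) \<Rightarrow> ('a, 'e) chart \<Rightarrow> 'a \<Rightarrow> 'e" where
  "outward_normal gbar r c p = - (r p *\<^sub>R gradient gbar r c p)"

text \<open>\<open>\<kappa> 1, \<dots>, \<kappa> n\<close> are the outward principal curvatures at \<open>p\<close> of the level set of \<open>r\<close> through
  \<open>p\<close>, whose tangent space is the kernel of \<open>dr\<close>.\<close>

definition outward_principal_curvatures ::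
    "('a, real \<times> 'e::euclidean_space) chart set \<Rightarrow> ('a, real \<times> 'e) tensor2 \<Rightarrow>
     ('a, real \<times> 'e) tensor2 \<Rightarrow> ('a \<Rightarrow> real) \<Rightarrow> 'a \<Rightarrow> (nat \<Rightarrow> real) \<Rightarrow> bool" where
  "outward_principal_curvatures A g gbar r p \<kappa> \<longleftrightarrow>
     (\<forall>c\<in>A. p \<in> fst c \<longrightarrow>
        eigenvalues_of DIM('e) {v. dif c r p v = 0} (g c p)
          (second_ff g (outward_normal gbar r) c p) \<kappa>)"

end

theory Submission
  imports Defs
begin

text \<open>
  Near the boundary \<open>g = r\<^sup>-\<^sup>2 (dr\<^sup>2 + g\<^sub>r)\<close>, so with \<open>N = - r \<partial>\<^sub>r\<close> the second fundamental form
  \<open>- \<L>\<^sub>N g / 2\<close> of a level set is \<open>(r / 2) d/dr (r\<^sup>-\<^sup>2 g\<^sub>r)\<close> on tangent vectors. Let \<open>S\<close> be the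
  self-adjoint operator of \<open>P\<close> with respect to \<open>\<gamma>\<close>, and \<open>B = r\<^sup>2 S / 2\<close>. The expansion of \<open>g\<^sub>r\<close> is
  the square \<open>\<gamma>((1 - B) u, (1 - B) v)\<close>, and differentiation gives the second fundamental form
  \<open>r\<^sup>-\<^sup>2 (- \<gamma>(u, v) + \<gamma>(B u, B v)) = - r\<^sup>-\<^sup>2 \<gamma>((1 + B) u, (1 - B) v)\<close>. Since \<open>g\<^sub>r\<close> is definite,
  \<open>1 - B\<close> is invertible, and an eigenvalue \<open>\<lambda>\<close> of \<open>P\<close> corresponds, with the same eigenspace, to the
  principal curvature \<open>\<kappa> = - (1 + b) / (1 - b) = 1 - 2 / (1 - b)\<close> with \<open>b = r\<^sup>2 \<lambda> / 2\<close>. This is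
  \<open>FG_eigenvalues\<close>.

  To make the first step precise, the product structure is written in charts as the collar map
  \<open>F(s, y)\<close> (\<open>collar_coordinates\<close>). Its image is open in the interior and it has a smooth inverse, so the
  field \<open>N\<close> is differentiable and \<open>F\<close>-related to \<open>- s \<partial>\<^sub>s\<close>. The naturality of the Lie derivative
  (\<open>lie_derivative_pullback\<close>), which rests on the symmetry of the second derivatives of \<open>F\<close>
  (\<open>symmetric_second_derivative\<close>), reduces its computation to a derivative of the pulled back metric in
  \<open>s\<close> (\<open>second_ff_in_collar\<close>).
\<close>

section \<open>Second derivatives of smooth maps\<close>

text \<open>The second difference of \<open>f\<close> along \<open>h u\<close> and \<open>h v\<close> is \<open>h\<^sup>2 A v + o(h\<^sup>2)\<close>, where \<open>A\<close> is the
  differential of the directional derivative along \<open>u\<close>: the mean value theorem along \<open>u\<close> turns it into a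
  first difference of that derivative. It is symmetric in \<open>u\<close> and \<open>v\<close>, hence so is \<open>A v\<close>.\<close>

lemma second_difference_estimate:
  fixes f :: "'a::real_normed_vector \<Rightarrow> real"
  assumes S: "open S" "x \<in> S" and f: "\<And>y. y \<in> S \<Longrightarrow> f differentiable (at y)"
    and A: "((\<lambda>y. frechet_derivative f (at y) u) has_derivative A) (at x)"
    and e: "e > 0"
  shows "\<exists>d>0. \<forall>h. 0 < h \<and> h < d \<longrightarrow>
    \<bar>f (x + h *\<^sub>R u + h *\<^sub>R v) - f (x + h *\<^sub>R u) - f (x + h *\<^sub>R v) + f x - h\<^sup>2 * A v\<bar> \<le> e * h\<^sup>2"
proof -
  define g where "g = (\<lambda>y. frechet_derivative f (at y) u)"
  define K where "K = norm u + norm v + 1"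
  have K: "K > 0" unfolding K_def by (smt (verit) norm_ge_zero)
  have linA: "linear A" using A has_derivative_linear by blast
  obtain \<rho> where \<rho>: "\<rho> > 0" "ball x \<rho> \<subseteq> S" using S openE by blast
  have "e / (2 * K) > 0" using e K by simp
  then obtain d0 where d0: "d0 > 0"
    "\<And>y. norm (y - x) < d0 \<Longrightarrow> norm (g y - g x - A (y - x)) \<le> e / (2 * K) * norm (y - x)"
    using A unfolding has_derivative_at_alt g_def by meson
  define d where "d = min \<rho> d0 / K"
  have "d > 0" using K \<rho> d0 by (simp add: d_def)
  moreover have "\<bar>f (x + h *\<^sub>R u + h *\<^sub>R v) - f (x + h *\<^sub>R u) - f (x + h *\<^sub>R v) + f x - h\<^sup>2 * A v\<bar> \<le> e * h\<^sup>2"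
    if h: "0 < h" "h < d" for h
  proof -
    have hK: "h * K < \<rho>" "h * K < d0"
      using h K by (auto simp: d_def pos_less_divide_eq)
    have small: "norm (\<tau> *\<^sub>R u + \<sigma> *\<^sub>R v) \<le> h * K" if "0 \<le> \<tau>" "\<tau> \<le> h" "0 \<le> \<sigma>" "\<sigma> \<le> h" for \<tau> \<sigma>
    proof -
      have "norm (\<tau> *\<^sub>R u + \<sigma> *\<^sub>R v) \<le> \<tau> * norm u + \<sigma> * norm v"
        using that by (intro norm_triangle_le) simp
      also have "\<dots> \<le> h * norm u + h * norm v"
        using that by (intro add_mono mult_right_mono) auto
      also have "\<dots> \<le> h * K" using h by (simp add: K_def algebra_simps)
      finally show ?thesis .
    qed
    have inS: "x + \<tau> *\<^sub>R u + \<sigma> *\<^sub>R v \<in> S" if "0 \<le> \<tau>" "\<tau> \<le> h" "0 \<le> \<sigma>" "\<sigma> \<le> h" for \<tau> \<sigma>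
    proof -
      have "dist x (x + \<tau> *\<^sub>R u + \<sigma> *\<^sub>R v) = norm (\<tau> *\<^sub>R u + \<sigma> *\<^sub>R v)"
        by (metis add.assoc add_diff_cancel_left' dist_commute dist_norm)
      then show ?thesis using small[OF that] hK \<rho> by (auto simp: subset_eq)
    qed
    have der: "((\<lambda>\<tau>. f (x + \<tau> *\<^sub>R u + \<sigma> *\<^sub>R v)) has_real_derivative g (x + \<tau> *\<^sub>R u + \<sigma> *\<^sub>R v)) (at \<tau>)"
      if "0 \<le> \<tau>" "\<tau> \<le> h" "0 \<le> \<sigma>" "\<sigma> \<le> h" for \<tau> \<sigma>
    proof -
      let ?y = "x + \<tau> *\<^sub>R u + \<sigma> *\<^sub>R v"
      have F: "(f has_derivative frechet_derivative f (at ?y)) (at ?y)"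
        using f[OF inS[OF that]] frechet_derivative_works by blast
      have "((\<lambda>\<tau>. x + \<tau> *\<^sub>R u + \<sigma> *\<^sub>R v) has_derivative (\<lambda>k. k *\<^sub>R u)) (at \<tau>)"
        by (auto intro!: derivative_eq_intros)
      from has_derivative_compose[OF this F]
      have "((\<lambda>\<tau>. f (x + \<tau> *\<^sub>R u + \<sigma> *\<^sub>R v)) has_derivative
          (\<lambda>k. frechet_derivative f (at ?y) (k *\<^sub>R u))) (at \<tau>)" .
      moreover have "frechet_derivative f (at ?y) (k *\<^sub>R u) = k * g ?y" for k
        unfolding g_def using linear_scale[OF has_derivative_linear[OF F]] by simp
      ultimately show ?thesis
        by (simp add: has_field_derivative_def mult.commute[of "g _"] mult_commute_abs)
    qed
    define \<phi> where "\<phi> \<tau> = f (x + \<tau> *\<^sub>R u + h *\<^sub>R v) - f (x + \<tau> *\<^sub>R u + 0 *\<^sub>R v)" for \<tau>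
    have "\<exists>z>0. z < h \<and> \<phi> h - \<phi> 0 =
        (h - 0) * (g (x + z *\<^sub>R u + h *\<^sub>R v) - g (x + z *\<^sub>R u + 0 *\<^sub>R v))"
      unfolding \<phi>_def by (rule MVT2[OF h(1)]) (intro DERIV_diff der; use h in simp)
    then obtain z where z: "0 < z" "z < h"
      and \<phi>: "\<phi> h - \<phi> 0 = h * (g (x + z *\<^sub>R u + h *\<^sub>R v) - g (x + z *\<^sub>R u + 0 *\<^sub>R v))" by auto
    have est: "\<bar>g (x + z *\<^sub>R u + \<sigma> *\<^sub>R v) - g x - A (z *\<^sub>R u + \<sigma> *\<^sub>R v)\<bar> \<le> e * h / 2"
      if "0 \<le> \<sigma>" "\<sigma> \<le> h" for \<sigma>
    proof -
      have sm: "norm (z *\<^sub>R u + \<sigma> *\<^sub>R v) \<le> h * K" using small that z by simp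
      have "norm (g (x + z *\<^sub>R u + \<sigma> *\<^sub>R v) - g x - A (z *\<^sub>R u + \<sigma> *\<^sub>R v)) \<le> e / (2 * K) * norm (z *\<^sub>R u + \<sigma> *\<^sub>R v)"
        using d0(2)[of "x + z *\<^sub>R u + \<sigma> *\<^sub>R v"] sm hK by (simp add: add.assoc)
      also have "\<dots> \<le> e / (2 * K) * (h * K)" using sm e K by (intro mult_left_mono) auto
      finally show ?thesis using K by simp
    qed
    have Adiff: "A (z *\<^sub>R u + h *\<^sub>R v) - A (z *\<^sub>R u + 0 *\<^sub>R v) = h * A v"
      using linear_add[OF linA] linear_scale[OF linA] by simp
    have "\<bar>g (x + z *\<^sub>R u + h *\<^sub>R v) - g (x + z *\<^sub>R u + 0 *\<^sub>R v) - h * A v\<bar> \<le> e * h"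
    proof -
      have "g (x + z *\<^sub>R u + h *\<^sub>R v) - g (x + z *\<^sub>R u + 0 *\<^sub>R v) - h * A v
          = (g (x + z *\<^sub>R u + h *\<^sub>R v) - g x - A (z *\<^sub>R u + h *\<^sub>R v))
            - (g (x + z *\<^sub>R u + 0 *\<^sub>R v) - g x - A (z *\<^sub>R u + 0 *\<^sub>R v))"
        using Adiff by linarith
      also have "\<bar>\<dots>\<bar> \<le> e * h / 2 + e * h / 2"
        using h by (intro order_trans[OF abs_triangle_ineq4] add_mono est) auto
      finally show ?thesis by simp
    qed
    then have "h * \<bar>g (x + z *\<^sub>R u + h *\<^sub>R v) - g (x + z *\<^sub>R u + 0 *\<^sub>R v) - h * A v\<bar> \<le> h * (e * h)"
      using h by (intro mult_left_mono) auto
    moreover have "h * \<bar>g (x + z *\<^sub>R u + h *\<^sub>R v) - g (x + z *\<^sub>R u + 0 *\<^sub>R v) - h * A v\<bar>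
        = \<bar>\<phi> h - \<phi> 0 - h\<^sup>2 * A v\<bar>"
    proof -
      have "h * \<bar>a\<bar> = \<bar>h * a\<bar>" for a using h by (simp add: abs_mult)
      then show ?thesis unfolding \<phi> by (simp add: power2_eq_square algebra_simps)
    qed
    ultimately show ?thesis by (simp add: \<phi>_def power2_eq_square algebra_simps)
  qed
  ultimately show ?thesis by blast
qed

lemma symmetric_second_derivative_real:
  fixes f :: "'a::real_normed_vector \<Rightarrow> real"
  assumes S: "open S" "x \<in> S" and f: "\<And>y. y \<in> S \<Longrightarrow> f differentiable (at y)"
    and A: "((\<lambda>y. frechet_derivative f (at y) u) has_derivative A) (at x)"
    and B: "((\<lambda>y. frechet_derivative f (at y) v) has_derivative B) (at x)"
  shows "A v = B u"
proof -
  have "\<bar>A v - B u\<bar> \<le> 0 + e" if e: "e > 0" for e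
  proof -
    obtain d1 where d1: "d1 > 0" "\<And>h. 0 < h \<and> h < d1 \<Longrightarrow>
        \<bar>f (x + h *\<^sub>R u + h *\<^sub>R v) - f (x + h *\<^sub>R u) - f (x + h *\<^sub>R v) + f x - h\<^sup>2 * A v\<bar> \<le> e / 2 * h\<^sup>2"
      using second_difference_estimate[OF S f A, of "e / 2" v] e by auto
    obtain d2 where d2: "d2 > 0" "\<And>h. 0 < h \<and> h < d2 \<Longrightarrow>
        \<bar>f (x + h *\<^sub>R v + h *\<^sub>R u) - f (x + h *\<^sub>R v) - f (x + h *\<^sub>R u) + f x - h\<^sup>2 * B u\<bar> \<le> e / 2 * h\<^sup>2"
      using second_difference_estimate[OF S f B, of "e / 2" u] e by auto
    define h where "h = min d1 d2 / 2"
    have h: "0 < h" "h < d1" "h < d2" using d1(1) d2(1) by (auto simp: h_def)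
    have swap: "x + h *\<^sub>R v + h *\<^sub>R u = x + h *\<^sub>R u + h *\<^sub>R v" by simp
    have "\<bar>h\<^sup>2 * A v - h\<^sup>2 * B u\<bar> \<le> e * h\<^sup>2"
      using d1(2)[of h] d2(2)[of h] h unfolding swap by argo
    moreover have "\<bar>h\<^sup>2 * A v - h\<^sup>2 * B u\<bar> = h\<^sup>2 * \<bar>A v - B u\<bar>"
      by (simp add: abs_mult flip: right_diff_distrib)
    ultimately have "h\<^sup>2 * \<bar>A v - B u\<bar> \<le> h\<^sup>2 * e" by (simp add: mult.commute)
    then show ?thesis using h(1) by simp
  qed
  then have "\<bar>A v - B u\<bar> \<le> 0" by (rule field_le_epsilon)
  then show ?thesis by simp
qed

text \<open>Young's form of the symmetry of mixed partial derivatives: differentiability of the two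
  directional derivatives at the point suffices.\<close>

lemma symmetric_second_derivative:
  fixes f :: "'a::real_normed_vector \<Rightarrow> 'b::euclidean_space"
  assumes S: "open S" "x \<in> S" and f: "\<And>y. y \<in> S \<Longrightarrow> f differentiable (at y)"
    and A: "((\<lambda>y. frechet_derivative f (at y) u) has_derivative A) (at x)"
    and B: "((\<lambda>y. frechet_derivative f (at y) v) has_derivative B) (at x)"
  shows "A v = B u"
proof (rule euclidean_eqI)
  fix b :: 'b assume "b \<in> Basis"
  have comp: "((\<lambda>y. f y \<bullet> b) has_derivative (\<lambda>w. frechet_derivative f (at y) w \<bullet> b)) (at y)"
    if "y \<in> S" for y
    using f[OF that] frechet_derivative_works has_derivative_inner_left by blast
  have fd: "frechet_derivative f (at y) w \<bullet> b = frechet_derivative (\<lambda>y. f y \<bullet> b) (at y) w"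
    if "y \<in> S" for y w
    using frechet_derivative_at[OF comp[OF that]] by metis
  have C: "((\<lambda>y. frechet_derivative (\<lambda>y. f y \<bullet> b) (at y) w) has_derivative (\<lambda>w. C w \<bullet> b)) (at x)"
    if "((\<lambda>y. frechet_derivative f (at y) w) has_derivative C) (at x)" for w C
    by (rule has_derivative_transform_within_open[OF has_derivative_inner_left[OF that] S fd])
  show "A v \<bullet> b = B u \<bullet> b"
    using symmetric_second_derivative_real[OF S _ C[OF A] C[OF B]] comp
    unfolding differentiable_def by blast
qed

lemma differentiable_transform_within_open:
  assumes "f differentiable (at x)" "open S" "x \<in> S" "\<And>y. y \<in> S \<Longrightarrow> f y = g y"
  shows "g differentiable (at x)"
proof -
  obtain D where "(f has_derivative D) (at x)" using assms(1) unfolding differentiable_def by blast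
  from has_derivative_transform_within_open[OF this assms(2-4)]
  show ?thesis unfolding differentiable_def by blast
qed

text \<open>In \<open>Ck_on\<close> only the derivatives along basis vectors are regular by definition; the
  derivative along any \<open>v\<close> is a linear combination of these.\<close>

lemma Ck_on_2_differentiable:
  assumes h: "Ck_on 2 U h" and U: "open U" "x \<in> U"
  shows "h differentiable (at x)" "(\<lambda>y. frechet_derivative h (at y) v) differentiable (at x)"
proof -
  have h1: "\<And>y. y \<in> U \<Longrightarrow> h differentiable (at y)"
    and h2: "\<And>b. b \<in> Basis \<Longrightarrow> (\<lambda>y. frechet_derivative h (at y) b) differentiable (at x)"
    using h U by (auto simp: numeral_2_eq_2)
  show "h differentiable (at x)" using h1 U by blast
  have "(\<lambda>y. \<Sum>b\<in>Basis. (v \<bullet> b) *\<^sub>R frechet_derivative h (at y) b) differentiable (at x)"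
    using h2 by (intro differentiable_sum) auto
  moreover have "(\<Sum>b\<in>Basis. (v \<bullet> b) *\<^sub>R frechet_derivative h (at y) b) = frechet_derivative h (at y) v"
    if "y \<in> U" for y
  proof -
    have "linear (frechet_derivative h (at y))"
      using h1[OF that] linear_frechet_derivative by blast
    then have "frechet_derivative h (at y) (\<Sum>b\<in>Basis. (v \<bullet> b) *\<^sub>R b) =
        (\<Sum>b\<in>Basis. (v \<bullet> b) *\<^sub>R frechet_derivative h (at y) b)"
      by (simp add: linear_sum linear_scale)
    then show ?thesis by (simp add: euclidean_representation)
  qed
  ultimately show "(\<lambda>y. frechet_derivative h (at y) v) differentiable (at x)"
    by (rule differentiable_transform_within_open[OF _ U])
qed

lemma smooth_on_open_differentiable:
  assumes f: "smooth_on S f" and S: "open S" "x \<in> S"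
  shows "f differentiable (at x)" "(\<lambda>y. frechet_derivative f (at y) v) differentiable (at x)"
proof -
  obtain U h where U: "open U" "x \<in> U" and h': "\<forall>k. Ck_on k U h"
    and eq': "\<forall>y\<in>U \<inter> S. h y = f y"
    using bspec[OF f[unfolded smooth_on_def] S(2)] by blast
  have h: "Ck_on 2 U h" using h' by blast
  have eq: "h y = f y" if "y \<in> U \<inter> S" for y using eq' that by blast
  let ?U = "U \<inter> S"
  have W: "open ?U" "x \<in> ?U" using U S by auto
  have tr: "(h has_derivative D) (at y) \<longleftrightarrow> (f has_derivative D) (at y)" if "y \<in> ?U" for y D
  proof
    show "(f has_derivative D) (at y)" if "(h has_derivative D) (at y)"
      by (rule has_derivative_transform_within_open[OF that W(1) \<open>y \<in> ?U\<close> eq])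
    show "(h has_derivative D) (at y)" if "(f has_derivative D) (at y)"
      by (rule has_derivative_transform_within_open[OF that W(1) \<open>y \<in> ?U\<close> eq[symmetric]])
  qed
  show "f differentiable (at x)"
    using Ck_on_2_differentiable(1)[OF h U] tr[OF W(2)] by (simp add: differentiable_def)
  have fd: "frechet_derivative h (at y) v = frechet_derivative f (at y) v" if "y \<in> ?U" for y
    unfolding frechet_derivative_def using tr[OF that] by simp
  show "(\<lambda>y. frechet_derivative f (at y) v) differentiable (at x)"
    by (rule differentiable_transform_within_open[OF Ck_on_2_differentiable(2)[OF h U] W fd])
qed

lemma smooth_on_subset:
  assumes "smooth_on S f" "R \<subseteq> S"
  shows "smooth_on R f"
  unfolding smooth_on_def
proof
  fix x assume "x \<in> R"
  then obtain U h where "open U" "x \<in> U" "\<forall>k. Ck_on k U h" "\<forall>y\<in>U \<inter> S. h y = f y"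
    using assms(1)[unfolded smooth_on_def, THEN bspec, of x] assms(2) by blast
  moreover from this have "\<forall>y\<in>U \<inter> R. h y = f y" using assms(2) by blast
  ultimately show "\<exists>U h. open U \<and> x \<in> U \<and> (\<forall>k. Ck_on k U h) \<and> (\<forall>y\<in>U \<inter> R. h y = f y)"
    by blast
qed


section \<open>The Lie derivative of a metric\<close>

lemma bilinear_basis_expansion:
  fixes B :: "'a::euclidean_space \<Rightarrow> 'b::euclidean_space \<Rightarrow> real"
  assumes "bilinear B"
  shows "B u v = (\<Sum>i\<in>Basis. \<Sum>j\<in>Basis. (u \<bullet> i) * (v \<bullet> j) * B i j)"
proof -
  have l: "\<And>y. linear (\<lambda>x. B x y)" and r: "\<And>x. linear (B x)"
    using assms by (auto simp: bilinear_def)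
  have "B u v = B (\<Sum>i\<in>Basis. (u \<bullet> i) *\<^sub>R i) v" by (simp add: euclidean_representation)
  also have "\<dots> = (\<Sum>i\<in>Basis. (u \<bullet> i) * B i v)"
    by (simp add: linear_sum[OF l] linear_scale[OF l])
  also have "\<dots> = (\<Sum>i\<in>Basis. (u \<bullet> i) * B i (\<Sum>j\<in>Basis. (v \<bullet> j) *\<^sub>R j))"
    by (simp add: euclidean_representation)
  also have "\<dots> = (\<Sum>i\<in>Basis. \<Sum>j\<in>Basis. (u \<bullet> i) * (v \<bullet> j) * B i j)"
    by (simp add: linear_sum[OF r] linear_scale[OF r] sum_distrib_left mult.assoc)
  finally show ?thesis .
qed

text \<open>The product rule for \<open>G\<^bsub>F y\<^esub>(a y, b y)\<close>, where the bilinear form \<open>G\<close> depends on the point.\<close>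

lemma has_derivative_moving_bilinear:
  fixes F :: "'a::euclidean_space \<Rightarrow> 'b::euclidean_space"
    and G :: "'b \<Rightarrow> 'b \<Rightarrow> 'b \<Rightarrow> real"
  assumes S: "open S" "z \<in> S" and Z: "open Z" "\<And>y. y \<in> S \<Longrightarrow> F y \<in> Z"
    and bil: "\<And>x. x \<in> Z \<Longrightarrow> bilinear (G x)"
    and G: "\<And>u v. (\<lambda>x. G x u v) differentiable (at (F z))"
    and F: "(F has_derivative F') (at z)"
    and a: "(a has_derivative a') (at z)" and b: "(b has_derivative b') (at z)"
  shows "((\<lambda>y. G (F y) (a y) (b y)) has_derivative
    (\<lambda>w. frechet_derivative (\<lambda>x. G x (a z) (b z)) (at (F z)) (F' w)
       + G (F z) (a' w) (b z) + G (F z) (a z) (b' w))) (at z)"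
proof -
  define D where "D u v = frechet_derivative (\<lambda>x. G x u v) (at (F z))" for u v
  have D: "((\<lambda>x. G x u v) has_derivative D u v) (at (F z))" for u v
    unfolding D_def using G frechet_derivative_works by blast
  have D_expand: "D u v = (\<lambda>w. \<Sum>i\<in>Basis. \<Sum>j\<in>Basis. (u \<bullet> i) * (v \<bullet> j) * D i j w)" for u v
  proof -
    have "((\<lambda>x. \<Sum>i\<in>Basis. \<Sum>j\<in>Basis. (u \<bullet> i) * (v \<bullet> j) * G x i j) has_derivative
        (\<lambda>w. \<Sum>i\<in>Basis. \<Sum>j\<in>Basis. (u \<bullet> i) * (v \<bullet> j) * D i j w)) (at (F z))"
      by (intro has_derivative_sum has_derivative_mult_right D)
    then have "((\<lambda>x. G x u v) has_derivative
        (\<lambda>w. \<Sum>i\<in>Basis. \<Sum>j\<in>Basis. (u \<bullet> i) * (v \<bullet> j) * D i j w)) (at (F z))"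
      by (rule has_derivative_transform_within_open[OF _ Z(1) Z(2)[OF S(2)]])
        (rule bilinear_basis_expansion[OF bil, symmetric])
    then show ?thesis using has_derivative_unique[OF D] by blast
  qed
  have GF: "((\<lambda>y. G (F y) u v) has_derivative (\<lambda>w. D u v (F' w))) (at z)" for u v
    using has_derivative_compose[OF F D] .
  have "((\<lambda>y. \<Sum>i\<in>Basis. \<Sum>j\<in>Basis. (a y \<bullet> i) * (b y \<bullet> j) * G (F y) i j) has_derivative
      (\<lambda>w. \<Sum>i\<in>Basis. \<Sum>j\<in>Basis. (a z \<bullet> i) * (b z \<bullet> j) * D i j (F' w)
         + ((a z \<bullet> i) * (b' w \<bullet> j) + (a' w \<bullet> i) * (b z \<bullet> j)) * G (F z) i j)) (at z)"
    by (intro has_derivative_sum has_derivative_mult has_derivative_inner_left a b GF)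
  moreover have "(\<Sum>i\<in>Basis. \<Sum>j\<in>Basis. (a z \<bullet> i) * (b z \<bullet> j) * D i j (F' w)
         + ((a z \<bullet> i) * (b' w \<bullet> j) + (a' w \<bullet> i) * (b z \<bullet> j)) * G (F z) i j)
      = D (a z) (b z) (F' w) + G (F z) (a' w) (b z) + G (F z) (a z) (b' w)" for w
    unfolding D_expand[of "a z" "b z"]
      bilinear_basis_expansion[OF bil[OF Z(2)[OF S(2)]], of "a' w" "b z"]
      bilinear_basis_expansion[OF bil[OF Z(2)[OF S(2)]], of "a z" "b' w"]
    by (simp add: sum.distrib algebra_simps)
  ultimately have "((\<lambda>y. \<Sum>i\<in>Basis. \<Sum>j\<in>Basis. (a y \<bullet> i) * (b y \<bullet> j) * G (F y) i j) has_derivative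
      (\<lambda>w. D (a z) (b z) (F' w) + G (F z) (a' w) (b z) + G (F z) (a z) (b' w))) (at z)"
    by simp
  then show ?thesis unfolding D_def
    by (rule has_derivative_transform_within_open[OF _ S])
      (rule bilinear_basis_expansion[OF bil[OF Z(2)], symmetric])
qed

text \<open>Naturality of the Lie derivative: if \<open>N\<close> corresponds under \<open>F\<close> to the field \<open>\<phi> e\<close>, where
  \<open>e\<close> is constant, then on the images of constant vectors annihilated by \<open>d\<phi>\<close> the Lie derivative
  of \<open>G\<close> is \<open>\<phi>\<close> times the derivative of the pulled back metric in the direction \<open>e\<close>.\<close>

lemma lie_derivative_pullback:
  fixes F :: "'a::euclidean_space \<Rightarrow> 'b::euclidean_space"
    and G :: "'b \<Rightarrow> 'b \<Rightarrow> 'b \<Rightarrow> real"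
  defines "DF \<equiv> \<lambda>y. frechet_derivative F (at y)"
  assumes S: "open S" "z \<in> S" and Z: "open Z" "\<And>y. y \<in> S \<Longrightarrow> F y \<in> Z"
    and bil: "\<And>x. x \<in> Z \<Longrightarrow> bilinear (G x)"
    and G: "\<And>u v. (\<lambda>x. G x u v) differentiable (at (F z))"
    and F: "\<And>y. y \<in> S \<Longrightarrow> F differentiable (at y)"
    and DF: "\<And>v. (\<lambda>y. DF y v) differentiable (at z)"
    and N: "N differentiable (at (F z))" "\<And>y. y \<in> S \<Longrightarrow> N (F y) = \<phi> y *\<^sub>R DF y e"
    and \<phi>: "(\<phi> has_derivative \<phi>') (at z)" "\<phi>' u = 0" "\<phi>' v = 0"
  obtains q' where "((\<lambda>y. G (F y) (DF y u) (DF y v)) has_derivative q') (at z)"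
    and "lie_derivative N G (F z) (DF z u) (DF z v) = \<phi> z * q' e"
proof -
  define DD where "DD w = frechet_derivative (\<lambda>y. DF y w) (at z)" for w
  have DD: "((\<lambda>y. DF y w) has_derivative DD w) (at z)" for w
    unfolding DD_def using DF frechet_derivative_works by blast
  have dF: "(F has_derivative DF z) (at z)"
    unfolding DF_def using F[OF S(2)] frechet_derivative_works by blast
  have sym: "DD w w' = DD w' w" for w w'
    by (rule symmetric_second_derivative[OF S F, where u = w and v = w'])
      (use DD in \<open>auto simp: DF_def\<close>)
  define q' where "q' w = frechet_derivative (\<lambda>x. G x (DF z u) (DF z v)) (at (F z)) (DF z w)
       + G (F z) (DD u w) (DF z v) + G (F z) (DF z u) (DD v w)" for w
  have q: "((\<lambda>y. G (F y) (DF y u) (DF y v)) has_derivative q') (at z)"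
    unfolding q'_def by (rule has_derivative_moving_bilinear[OF S Z bil G dF DD DD])
  define N' where "N' = frechet_derivative N (at (F z))"
  have "(N has_derivative N') (at (F z))"
    unfolding N'_def using N(1) frechet_derivative_works by blast
  from has_derivative_compose[OF dF this]
  have N1: "((\<lambda>y. N (F y)) has_derivative (\<lambda>w. N' (DF z w))) (at z)" .
  have N2: "((\<lambda>y. N (F y)) has_derivative (\<lambda>w. \<phi> z *\<^sub>R DD e w + \<phi>' w *\<^sub>R DF z e)) (at z)"
    by (rule has_derivative_transform_within_open[OF has_derivative_scaleR[OF \<phi>(1) DD] S])
      (simp add: N(2))
  \<comment> \<open>Both sides are the differential of \<open>N \<circ> F = \<phi> DF e\<close>.\<close>
  have N': "N' (DF z w) = \<phi> z *\<^sub>R DD e w + \<phi>' w *\<^sub>R DF z e" for w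
    using fun_cong[OF has_derivative_unique[OF N1 N2]] .
  have "bilinear (G (F z))" using bil Z S by blast
  then have scale: "G (F z) (k *\<^sub>R a) b = k * G (F z) a b" "G (F z) a (k *\<^sub>R b) = k * G (F z) a b" for k a b
    by (simp_all add: bilinear_lmul bilinear_rmul)
  have "linear (frechet_derivative (\<lambda>x. G x (DF z u) (DF z v)) (at (F z)))"
    using G linear_frechet_derivative by blast
  then have "lie_derivative N G (F z) (DF z u) (DF z v) = \<phi> z * q' e"
    unfolding lie_derivative_def N'_def[symmetric] q'_def N(2)[OF S(2)] N' \<phi>
    by (simp add: linear_scale scale sym[of e] algebra_simps)
  with q show ?thesis by (rule that)
qed


section \<open>Eigenvalues of the pulled back forms\<close>

text \<open>The Riesz representation for a positive definite form, which need not be assumed symmetric.\<close>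

lemma raise_works:
  fixes G :: "'e::euclidean_space \<Rightarrow> 'e \<Rightarrow> real"
  assumes G: "bilinear G" and pos: "\<And>u. u \<noteq> 0 \<Longrightarrow> G u u > 0" and \<alpha>: "linear \<alpha>"
  shows "G (raise G \<alpha>) z = \<alpha> z"
proof -
  have l: "\<And>y. linear (\<lambda>x. G x y)" and r: "\<And>x. linear (G x)"
    using G by (auto simp: bilinear_def)
  define T where "T w = (\<Sum>b\<in>Basis. G w b *\<^sub>R b)" for w
  have T: "T w \<bullet> z = G w z" for w z
  proof -
    have "G w z = G w (\<Sum>b\<in>Basis. (z \<bullet> b) *\<^sub>R b)" by (simp add: euclidean_representation)
    also have "\<dots> = (\<Sum>b\<in>Basis. (z \<bullet> b) * G w b)"
      by (simp add: linear_sum[OF r] linear_scale[OF r])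
    also have "\<dots> = T w \<bullet> z"
      by (simp add: T_def inner_sum_left inner_commute[of z] mult.commute)
    finally show ?thesis by simp
  qed
  have "linear T"
    unfolding T_def by (intro linear_compose_sum ballI linearI)
      (auto simp: linear_add[OF l] linear_scale[OF l] scaleR_add_left)
  moreover have zero: "w = 0" if "T w = 0" for w
    using T[of w w] that pos[of w] by force
  ultimately have "surj T"
    by (simp add: linear_injective_imp_surjective linear_injective_0)
  then obtain w where w: "T w = (\<Sum>b\<in>Basis. \<alpha> b *\<^sub>R b)" by (metis surjD)
  have "G w z = \<alpha> z" for z
  proof -
    have "G w z = (\<Sum>b\<in>Basis. \<alpha> b *\<^sub>R b) \<bullet> z" using T w by metis
    also have "\<dots> = (\<Sum>b\<in>Basis. (z \<bullet> b) * \<alpha> b)"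
      by (simp add: inner_sum_left inner_commute[of z] mult.commute)
    also have "\<dots> = \<alpha> (\<Sum>b\<in>Basis. (z \<bullet> b) *\<^sub>R b)"
      by (simp add: linear_sum[OF \<alpha>] linear_scale[OF \<alpha>])
    finally show ?thesis by (simp add: euclidean_representation)
  qed
  have "w' = w" if "\<forall>z. G w' z = \<alpha> z" for w'
  proof -
    have "G (w' - w) (w' - w) = 0"
      using linear_diff[OF l, of w' w] that \<open>\<And>z. G w z = \<alpha> z\<close> by simp
    then show ?thesis using pos[of "w' - w"] by force
  qed
  with \<open>\<And>z. G w z = \<alpha> z\<close> have "\<exists>!w. \<forall>z. G w z = \<alpha> z" by (intro ex1I[of _ w]) auto
  then have "\<forall>z. G (raise G \<alpha>) z = \<alpha> z" unfolding raise_def by (rule theI')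
  then show ?thesis by blast
qed

lemma eigenvalues_of_linear_image:
  fixes L :: "'e::euclidean_space \<Rightarrow> 'f::euclidean_space"
  assumes L: "linear L" "inj L" and V: "V = range L"
    and G: "\<And>u v. G' (L u) (L v) = G u v" and B: "\<And>u v. B' (L u) (L v) = B u v"
    and \<mu>: "eigenvalues_of k UNIV G B \<mu>"
  shows "eigenvalues_of k V G' B' \<mu>"
  unfolding eigenvalues_of_def
proof
  fix a
  have "{v \<in> V. \<forall>w\<in>V. B' v w = a * G' v w} = L ` {u. \<forall>w. B u w = a * G u w}"
    unfolding V using G B by auto
  moreover have "dim (L ` {u. \<forall>w. B u w = a * G u w}) = dim {u. \<forall>w. B u w = a * G u w}"
    using L by (intro dim_image_eq) (auto intro: inj_on_subset)
  ultimately show "card {i \<in> {1..k}. \<mu> i = a} = dim {v \<in> V. \<forall>w\<in>V. B' v w = a * G' v w}"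
    using \<mu> by (simp add: eigenvalues_of_def)
qed

text \<open>Write \<open>B = t\<^sup>2 S / 2\<close>, where \<open>S\<close> is the self-adjoint operator with \<open>\<gamma>(S u, v) = P(u, v)\<close>.
  The metric is \<open>\<gamma>((1 - B) u, (1 - B) v)\<close> and the second fundamental form is
  \<open>- \<gamma>((1 + B) u, (1 - B) v)\<close>, both up to the factor \<open>t\<^sup>-\<^sup>2\<close>. As the metric is definite, the factor
  \<open>1 - B\<close> cancels in the eigenvalue equation, which leaves \<open>-(1 + B) u = a (1 - B) u\<close>.\<close>

lemma FG_eigenvalues:
  fixes \<gamma> P :: "'e::euclidean_space \<Rightarrow> 'e \<Rightarrow> real" and t :: real
  defines "Q \<equiv> \<lambda>u v. P u (raise \<gamma> (P v))"
  defines "h \<equiv> \<lambda>u v. (\<gamma> u v - t\<^sup>2 * P u v + t ^ 4 / 4 * Q u v) / t\<^sup>2"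
  defines "K \<equiv> \<lambda>u v. (- \<gamma> u v + t ^ 4 / 4 * Q u v) / t\<^sup>2"
  assumes \<gamma>: "bilinear \<gamma>" "\<And>u v. \<gamma> u v = \<gamma> v u" "\<And>u. u \<noteq> 0 \<Longrightarrow> \<gamma> u u > 0"
    and P: "bilinear P" "\<And>u v. P u v = P v u"
    and t: "t > 0" and h: "\<And>u. u \<noteq> 0 \<Longrightarrow> h u u > 0"
    and eigs: "eigenvalues_of n UNIV \<gamma> P eigs"
  shows "\<And>i. i \<in> {1..n} \<Longrightarrow> 1 - t\<^sup>2 / 2 * eigs i \<noteq> 0"
    and "eigenvalues_of n UNIV h K (\<lambda>i. 1 - 2 / (1 - t\<^sup>2 / 2 * eigs i))"
proof -
  define B where "B u = (t\<^sup>2 / 2) *\<^sub>R raise \<gamma> (P u)" for u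
  have lin: "linear (P u)" for u using P(1) by (simp add: bilinear_def)
  have BP: "\<gamma> (B u) v = t\<^sup>2 / 2 * P u v" for u v
    unfolding B_def using raise_works[OF \<gamma>(1,3) lin] by (simp add: bilinear_lmul[OF \<gamma>(1)])
  have adj: "\<gamma> u (B v) = \<gamma> (B u) v" for u v
    using BP \<gamma>(2) P(2) by metis
  have BQ: "\<gamma> (B u) (B v) = t ^ 4 / 4 * Q u v" for u v
  proof -
    have "P u (B v) = t\<^sup>2 / 2 * Q u v"
      unfolding B_def Q_def using linear_scale[OF lin] by simp
    then show ?thesis unfolding BP by (simp add: power2_eq_square power4_eq_xxxx)
  qed
  have h_eq: "h u v * t\<^sup>2 = \<gamma> u v - 2 * \<gamma> (B u) v + \<gamma> (B u) (B v)" for u v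
    unfolding h_def BQ unfolding BP using t by simp
  have K_eq: "K u v * t\<^sup>2 = - \<gamma> u v + \<gamma> (B u) (B v)" for u v
    unfolding K_def BQ using t by simp
  note bil = bilinear_ladd[OF \<gamma>(1)] bilinear_radd[OF \<gamma>(1)] bilinear_lsub[OF \<gamma>(1)]
    bilinear_rsub[OF \<gamma>(1)] bilinear_lmul[OF \<gamma>(1)] bilinear_rmul[OF \<gamma>(1)]
  \<comment> \<open>\<open>1 - B\<close> is injective, because \<open>h\<close> is definite and factors through it.\<close>
  have nondeg: "u = 0" if "u = B u" for u
  proof (rule ccontr)
    assume "u \<noteq> 0"
    moreover have "h u u * t\<^sup>2 = 0"
      unfolding h_eq using that[symmetric] by simp
    ultimately show False using h[of u] t by simp
  qed
  have eig: "P u w = l * \<gamma> u w" if "\<gamma> (B u) w = (t\<^sup>2 / 2 * l) * \<gamma> u w" for u w l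
    using that t unfolding BP by (simp add: field_simps)
  have mult: "card {i \<in> {1..n}. eigs i = l} = dim {u. \<forall>w. P u w = l * \<gamma> u w}" for l
    using eigs by (simp add: eigenvalues_of_def)
  show ne: "1 - t\<^sup>2 / 2 * eigs i \<noteq> 0" if i: "i \<in> {1..n}" for i
  proof
    assume eq: "1 - t\<^sup>2 / 2 * eigs i = 0"
    have "card {j \<in> {1..n}. eigs j = eigs i} \<noteq> 0" using i by auto
    then have "dim {u. \<forall>w. P u w = eigs i * \<gamma> u w} \<noteq> 0"
      unfolding mult .
    then have "\<not> {u. \<forall>w. P u w = eigs i * \<gamma> u w} \<subseteq> {0}"
      by simp
    then obtain u where u: "u \<noteq> 0" "\<And>w. P u w = eigs i * \<gamma> u w" by auto
    have "\<gamma> (B u) w = (t\<^sup>2 / 2 * eigs i) * \<gamma> u w" for w unfolding BP u by simp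
    then have "\<gamma> (u - B u) (u - B u) = 0" using eq by (simp add: bil)
    then have "u = B u" using \<gamma>(3)[of "u - B u"] by force
    then show False using nondeg u by blast
  qed
  show "eigenvalues_of n UNIV h K (\<lambda>i. 1 - 2 / (1 - t\<^sup>2 / 2 * eigs i))"
    unfolding eigenvalues_of_def
  proof
    fix a
    \<comment> \<open>\<open>y u = - (1 + B) u - a (1 - B) u\<close>, and the eigenvalue equation reads \<open>(1 - B) (y u) = 0\<close>.\<close>
    define y where "y u = (a - 1) *\<^sub>R B u - (1 + a) *\<^sub>R u" for u
    have diff: "(K u w - a * h u w) * t\<^sup>2 = \<gamma> (y u) w - \<gamma> (B (y u)) w" for u w
    proof -
      have "(K u w - a * h u w) * t\<^sup>2 = K u w * t\<^sup>2 - a * (h u w * t\<^sup>2)"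
        by (simp add: algebra_simps)
      also have "\<dots> = \<gamma> (y u) w - \<gamma> (y u) (B w)"
        unfolding h_eq K_eq y_def by (simp add: bil adj[symmetric] algebra_simps)
      finally show ?thesis by (simp add: adj)
    qed
    have set_eq: "(\<forall>w. K u w = a * h u w) \<longleftrightarrow> y u = 0" for u
    proof
      assume *: "\<forall>w. K u w = a * h u w"
      have "\<gamma> (y u - B (y u)) w = 0" for w
        using diff[of u w] * by (simp add: bil)
      then have "y u - B (y u) = 0" using \<gamma>(3)[of "y u - B (y u)"] by force
      then show "y u = 0" using nondeg[of "y u"] by simp
    next
      assume "y u = 0"
      moreover have "\<gamma> (B 0) w = 0" for w
        unfolding BP using bilinear_lzero[OF P(1)] by simp
      ultimately have "(K u w - a * h u w) * t\<^sup>2 = 0" for w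
        unfolding diff by (simp add: bilinear_lzero[OF \<gamma>(1)])
      then show "\<forall>w. K u w = a * h u w" using t by simp
    qed
    show "card {i \<in> {1..n}. 1 - 2 / (1 - t\<^sup>2 / 2 * eigs i) = a} =
        dim {v \<in> UNIV. \<forall>w\<in>UNIV. K v w = a * h v w}"
    proof (cases "a = 1")
      case True
      have "{i \<in> {1..n}. 1 - 2 / (1 - t\<^sup>2 / 2 * eigs i) = a} = {}"
        using True ne by auto
      moreover have "{v. \<forall>w. K v w = a * h v w} = {0}"
        unfolding set_eq y_def using True by auto
      ultimately show ?thesis by simp
    next
      case False
      \<comment> \<open>The value at which \<open>a = 1 - 2 / (1 - t\<^sup>2 l / 2)\<close>.\<close>
      define l where "l = 2 / t\<^sup>2 * ((a + 1) / (a - 1))"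
      have l: "t\<^sup>2 / 2 * l = (a + 1) / (a - 1)" 
      proof -
        have "t\<^sup>2 / 2 * (2 / t\<^sup>2 * k) = k" for k using t by simp
        then show ?thesis unfolding l_def .
      qed
      have y0: "y u = 0 \<longleftrightarrow> (\<forall>w. P u w = l * \<gamma> u w)" for u
      proof
        assume "y u = 0"
        then have "(a - 1) *\<^sub>R B u = (1 + a) *\<^sub>R u" by (simp add: y_def)
        then have "(1 / (a - 1)) *\<^sub>R ((a - 1) *\<^sub>R B u) = (1 / (a - 1)) *\<^sub>R ((1 + a) *\<^sub>R u)" by simp
        then have "B u = ((a + 1) / (a - 1)) *\<^sub>R u" using False by (simp add: add.commute)
        then show "\<forall>w. P u w = l * \<gamma> u w"
          by (intro allI eig) (simp only: l bil real_scaleR_def)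
      next
        assume *: "\<forall>w. P u w = l * \<gamma> u w"
        have "\<gamma> (y u) w = 0" for w
        proof -
          have "\<gamma> (B u) w = (a + 1) / (a - 1) * \<gamma> u w"
            unfolding BP using * l by (metis mult.assoc)
          then show ?thesis unfolding y_def using False by (simp add: bil field_simps)
        qed
        then show "y u = 0" using \<gamma>(3)[of "y u"] by force
      qed
      have "1 - 2 / (1 - t\<^sup>2 / 2 * eigs i) = a \<longleftrightarrow> eigs i = l" if i: "i \<in> {1..n}" for i
      proof -
        define b where "b = t\<^sup>2 / 2 * eigs i"
        have "1 - b \<noteq> 0" using ne[OF i] by (simp add: b_def)
        then have "1 - 2 / (1 - b) = a \<longleftrightarrow> b = (a + 1) / (a - 1)"
          using False by (simp add: field_simps)
        also have "\<dots> \<longleftrightarrow> eigs i = l" unfolding l[symmetric] b_def using t by simp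
        finally show ?thesis by (simp add: b_def)
      qed
      then have "{i \<in> {1..n}. 1 - 2 / (1 - t\<^sup>2 / 2 * eigs i) = a} = {i \<in> {1..n}. eigs i = l}" by blast
      then show ?thesis using mult[of l] by (simp add: set_eq y0)
    qed
  qed
qed


section \<open>Charts near the boundary\<close>

lemma mbdry_subset_topspace:
  assumes "smooth_atlas H T A"
  shows "mbdry A \<subseteq> topspace T"
proof
  fix p assume "p \<in> mbdry A"
  then obtain c where "c \<in> A" "p \<in> fst c" by (auto simp: mbdry_def)
  then show "p \<in> topspace T" using assms by (auto simp: smooth_atlas_def)
qed

lemma is_chart_facts:
  assumes "is_chart H T c"
  shows "fst c \<subseteq> topspace T" "openin T (fst c)" "inj_on (snd c) (fst c)"
    "\<And>p. p \<in> fst c \<Longrightarrow> chart_inv c (snd c p) = p"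
    "\<And>y. y \<in> snd c ` fst c \<Longrightarrow> chart_inv c y \<in> fst c"
    "\<And>y. y \<in> snd c ` fst c \<Longrightarrow> snd c (chart_inv c y) = y"
    "snd c ` fst c \<subseteq> H"
proof -
  have o: "openin T (fst c)" and oH: "openin (top_of_set H) (snd c ` fst c)"
    and h: "homeomorphic_map (subtopology T (fst c)) (top_of_set (snd c ` fst c)) (snd c)"
    using assms by (auto simp: is_chart_def)
  show "openin T (fst c)" by (rule o)
  show sub: "fst c \<subseteq> topspace T" using o openin_subset by blast
  show inj: "inj_on (snd c) (fst c)"
    using homeomorphic_imp_injective_map[OF h] sub by (simp add: Int_absorb1)
  show "\<And>p. p \<in> fst c \<Longrightarrow> chart_inv c (snd c p) = p"
    using inj by (simp add: chart_inv_def inv_into_f_f)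
  show "\<And>y. y \<in> snd c ` fst c \<Longrightarrow> chart_inv c y \<in> fst c"
    unfolding chart_inv_def by (rule inv_into_into)
  show "\<And>y. y \<in> snd c ` fst c \<Longrightarrow> snd c (chart_inv c y) = y"
    unfolding chart_inv_def by (rule f_inv_into_f)
  show "snd c ` fst c \<subseteq> H" using openin_subset[OF oH] by simp
qed

lemma continuous_map_chart_inv:
  assumes c: "is_chart H T c"
  shows "continuous_map (top_of_set (snd c ` fst c)) T (chart_inv c)"
proof -
  note cf = is_chart_facts[OF c]
  have h: "homeomorphic_map (subtopology T (fst c)) (top_of_set (snd c ` fst c)) (snd c)"
    using c by (simp add: is_chart_def)
  then obtain k where k: "homeomorphic_maps (subtopology T (fst c)) (top_of_set (snd c ` fst c)) (snd c) k"
    using homeomorphic_map_maps by blast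
  then have "continuous_map (top_of_set (snd c ` fst c)) T k"
    by (auto simp: homeomorphic_maps_def continuous_map_in_subtopology)
  moreover have "k y = chart_inv c y" if "y \<in> topspace (top_of_set (snd c ` fst c))" for y
  proof -
    obtain p where p: "p \<in> fst c" "y = snd c p" using \<open>y \<in> _\<close> by auto
    then have "k y = p" using k cf(1) by (auto simp: homeomorphic_maps_def)
    then show ?thesis using p cf(4) by simp
  qed
  ultimately show ?thesis by (rule continuous_map_eq)
qed

lemma open_fst_pos: "open {z::real \<times> 'e::euclidean_space. 0 < fst z}"
  by (rule open_Collect_less[OF continuous_on_const continuous_on_fst[OF continuous_on_id]])

text \<open>Chart images are only relatively open in the half space; those of open sets which miss the
  boundary are open.\<close>

lemma open_chart_image:
  assumes c: "is_chart halfspace T c" and W: "openin T W" "W \<subseteq> fst c"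
    and int: "\<And>p. p \<in> W \<Longrightarrow> fst (snd c p) \<noteq> 0"
  shows "open (snd c ` W)"
proof -
  have h: "homeomorphic_map (subtopology T (fst c)) (top_of_set (snd c ` fst c)) (snd c)"
    and o: "openin (top_of_set halfspace) (snd c ` fst c)"
    using c by (auto simp: is_chart_def)
  have "openin (subtopology T (fst c)) W" using W 
    by (simp add: openin_open_subtopology is_chart_facts(2)[OF c])
  then have "openin (top_of_set (snd c ` fst c)) (snd c ` W)"
    using homeomorphic_imp_open_map[OF h] unfolding open_map_def by blast
  then have "openin (top_of_set halfspace) (snd c ` W)"
    using o openin_trans by blast
  then obtain U where U: "open U" "snd c ` W = halfspace \<inter> U"
    unfolding openin_open by blast
  have "snd c ` W = U \<inter> {z. 0 < fst z}"
  proof (intro equalityI subsetI)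
    fix z assume z: "z \<in> snd c ` W"
    then have "fst z \<noteq> 0" using int by auto
    then show "z \<in> U \<inter> {z. 0 < fst z}" using z U(2) by (auto simp: halfspace_def)
  next
    fix z assume "z \<in> U \<inter> {z. 0 < fst z}"
    then show "z \<in> snd c ` W" unfolding U(2) by (auto simp: halfspace_def)
  qed
  then show ?thesis using U(1) open_fst_pos by auto
qed

text \<open>Coordinates of boundary points lie on the boundary of the half space in every chart. Here
  this follows from the existence of a defining function: at a point that is interior in one chart
  and a boundary point in another, it would have a minimum and hence a vanishing differential.\<close>

lemma mbdry_coordinate_zero:
  assumes A: "smooth_atlas halfspace T A" and r: "defining_function T A r"
    and c: "c \<in> A" and p: "p \<in> fst c" "p \<in> mbdry A"
  shows "fst (snd c p) = 0"
proof (rule ccontr)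
  assume nz: "fst (snd c p) \<noteq> 0"
  have ch: "is_chart halfspace T c" using A c by (simp add: smooth_atlas_def)
  note cf = is_chart_facts[OF ch]
  let ?U = "snd c ` fst c \<inter> {z. 0 < fst z}" and ?z = "snd c p"
  obtain O' where O': "open O'" "snd c ` fst c = halfspace \<inter> O'"
    using ch unfolding is_chart_def openin_open by blast
  have "?U = O' \<inter> {z. 0 < fst z}" unfolding O' halfspace_def by auto
  then have U: "open ?U" using O' open_fst_pos by auto
  have "?z \<in> halfspace" using cf(7) p by auto
  then have z: "?z \<in> ?U" using nz p by (auto simp: halfspace_def)
  have "smooth_on (snd c ` (fst c \<inter> topspace T)) (r \<circ> chart_inv c)"
    using r c by (simp add: defining_function_def smooth_fun_def)
  then have "smooth_on ?U (r \<circ> chart_inv c)"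
    using cf(1) by (auto elim!: smooth_on_subset)
  then obtain D where D: "((r \<circ> chart_inv c) has_derivative D) (at ?z)"
    using smooth_on_open_differentiable(1)[OF _ U z] unfolding differentiable_def by blast
  have "(r \<circ> chart_inv c) ?z \<le> (r \<circ> chart_inv c) y" if "y \<in> ?U" for y
  proof -
    have "chart_inv c y \<in> topspace T" using that cf(1,5) by blast
    then have "0 \<le> r (chart_inv c y)"
      using r by (cases "chart_inv c y \<in> mbdry A") (auto simp: defining_function_def mint_def less_imp_le)
    moreover have "r p = 0" using r p by (simp add: defining_function_def)
    ultimately show ?thesis using cf(4)[OF p(1)] by simp
  qed
  then have "D = (\<lambda>v. 0)" using differential_zero_maxmin[OF z U D] by blast
  moreover have "at ?z within snd c ` fst c = at ?z"
    using z U by (metis Int_lower1 at_within_open_subset)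
  then have "dif c r p = D"
    unfolding dif_def using frechet_derivative_at[OF D] by simp
  moreover have "\<exists>v. dif c r p v \<noteq> 0" using r c p by (simp add: defining_function_def)
  ultimately show False by simp
qed

lemma bchart_facts:
  assumes A: "smooth_atlas halfspace T A" and r: "defining_function T A r" and c: "c \<in> A"
  defines "d \<equiv> bchart A c"
  shows "open (snd d ` fst d)" "fst d = fst c \<inter> mbdry A"
    "\<And>q. q \<in> fst d \<Longrightarrow> chart_inv d (snd d q) = q"
    "\<And>y. y \<in> snd d ` fst d \<Longrightarrow> chart_inv d y \<in> fst d"
    "\<And>y. y \<in> snd d ` fst d \<Longrightarrow> snd d (chart_inv d y) = y"
    "continuous_map (top_of_set (snd d ` fst d)) (subtopology T (mbdry A)) (chart_inv d)"
proof -
  have ch: "is_chart halfspace T c" using A c by (simp add: smooth_atlas_def)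
  note cf = is_chart_facts[OF ch]
  show fd: "fst d = fst c \<inter> mbdry A" by (simp add: d_def bchart_def)
  have coord: "snd c q = (0, snd d q)" if "q \<in> fst d" for q
    using mbdry_coordinate_zero[OF A r c, of q] that
    by (simp add: fd) (simp add: d_def bchart_def prod_eq_iff)
  have inj: "inj_on (snd d) (fst d)"
    using cf(3) coord by (metis (no_types, lifting) Int_iff fd inj_onD inj_onI)
  show inv: "\<And>q. q \<in> fst d \<Longrightarrow> chart_inv d (snd d q) = q"
    using inj by (simp add: chart_inv_def inv_into_f_f)
  show into: "\<And>y. y \<in> snd d ` fst d \<Longrightarrow> chart_inv d y \<in> fst d"
    unfolding chart_inv_def by (rule inv_into_into)
  show "\<And>y. y \<in> snd d ` fst d \<Longrightarrow> snd d (chart_inv d y) = y"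
    unfolding chart_inv_def by (rule f_inv_into_f)
  have img: "snd d ` fst d = {y. (0, y) \<in> snd c ` fst c}"
  proof (intro equalityI subsetI)
    fix y assume "y \<in> snd d ` fst d"
    then obtain q where "q \<in> fst d" "y = snd d q" by blast
    then show "y \<in> {y. (0, y) \<in> snd c ` fst c}" using coord[of q] fd by force
  next
    fix y assume "y \<in> {y. (0, y) \<in> snd c ` fst c}"
    then obtain q where q: "q \<in> fst c" "snd c q = (0, y)" by force
    then have "q \<in> fst d" using c by (auto simp: fd mbdry_def)
    then show "y \<in> snd d ` fst d" using coord[of q] q by force
  qed
  obtain U where U: "open U" "snd c ` fst c = halfspace \<inter> U"
    using ch unfolding is_chart_def openin_open by blast
  have "snd d ` fst d = Pair 0 -` U"
    unfolding img U(2) by (auto simp: halfspace_def)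
  moreover have "open (Pair 0 -` U)"
    by (rule open_vimage[OF U(1)]) (intro continuous_intros)
  ultimately show "open (snd d ` fst d)" by simp
  have "continuous_map (top_of_set (snd d ` fst d)) (top_of_set (snd c ` fst c)) (Pair 0)"
    by (auto simp: continuous_map_in_subtopology img intro!: continuous_intros)
  from continuous_map_compose[OF this continuous_map_chart_inv[OF ch]]
  have "continuous_map (top_of_set (snd d ` fst d)) T (chart_inv c \<circ> Pair 0)" .
  moreover have "(chart_inv c \<circ> Pair 0) y = chart_inv d y"
    if "y \<in> topspace (top_of_set (snd d ` fst d))" for y
  proof -
    obtain q where q: "q \<in> fst d" "y = snd d q" using \<open>y \<in> _\<close> by auto
    then show ?thesis using inv[OF q(1)] coord[OF q(1)] cf(4)[of q] fd by simp
  qed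
  ultimately have "continuous_map (top_of_set (snd d ` fst d)) T (chart_inv d)"
    by (rule continuous_map_eq)
  then show "continuous_map (top_of_set (snd d ` fst d)) (subtopology T (mbdry A)) (chart_inv d)"
    using into fd by (auto simp: continuous_map_in_subtopology)
qed


section \<open>Collar coordinates\<close>

text \<open>The product structure \<open>\<Phi>\<close> in coordinates: on the parameter side \<open>r\<close> and a chart \<open>d\<close> of the
  boundary, on the manifold side a chart \<open>c\<close>; \<open>collar_dom\<close> is its domain, with \<open>r = 0\<close> removed.\<close>

definition collar_map ::
    "('a \<times> real \<Rightarrow> 'a) \<Rightarrow> ('a, 'f) chart \<Rightarrow> ('a, 'e) chart \<Rightarrow> real \<times> 'e \<Rightarrow> 'f" where
  "collar_map \<Phi> c d = (\<lambda>(s, y). snd c (\<Phi> (chart_inv d y, s)))"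

definition collar_dom ::
    "('a \<times> real \<Rightarrow> 'a) \<Rightarrow> real \<Rightarrow> ('a, 'f) chart \<Rightarrow> ('a, 'e) chart \<Rightarrow> (real \<times> 'e) set" where
  "collar_dom \<Phi> \<epsilon> c d =
     {(s, y). s \<in> {0<..<\<epsilon>} \<and> y \<in> snd d ` fst d \<and> \<Phi> (chart_inv d y, s) \<in> fst c}"

text \<open>The collar coordinates are smooth on part of the interior, with smooth inverse, in which \<open>r\<close> is
  the first coordinate and its gradient the first coordinate field. In particular the image is open,
  so that vector fields given along the collar map can be differentiated on the manifold side.\<close>

lemma collar_coordinates:
  fixes A :: "('a, real \<times> 'e::euclidean_space) chart set"
  assumes A: "smooth_atlas halfspace T A" and r: "defining_function T A r"
    and \<Phi>: "product_structure T A gbar r \<epsilon> \<Phi>"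
    and c: "c \<in> A" and c': "c' \<in> A"
  defines "d \<equiv> bchart A c'"
  defines "S \<equiv> collar_dom \<Phi> \<epsilon> c d"
  defines "F \<equiv> collar_map \<Phi> c d"
  shows "open S" and "smooth_on S F" and "open (F ` S)"
    and "\<exists>\<Psi>. smooth_on (F ` S) \<Psi> \<and> (\<forall>z\<in>S. \<Psi> (F z) = z)"
    and "\<And>s y. (s, y) \<in> S \<Longrightarrow> chart_inv c (F (s, y)) = \<Phi> (chart_inv d y, s)"
    and "\<And>s y. (s, y) \<in> S \<Longrightarrow> \<Phi> (chart_inv d y, s) \<in> fst c \<inter> mint T A"
    and "\<And>s y. (s, y) \<in> S \<Longrightarrow> r (\<Phi> (chart_inv d y, s)) = s"
    and "\<And>s y. (s, y) \<in> S \<Longrightarrow> ((\<lambda>s. F (s, y)) has_vector_derivative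
          gradient gbar r c (\<Phi> (chart_inv d y, s))) (at s)"
proof -
  have ch: "is_chart halfspace T c" using A c by (simp add: smooth_atlas_def)
  note cf = is_chart_facts[OF ch]
  note df = bchart_facts[OF A r c', folded d_def]
  let ?M = "mbdry A" and ?W = "\<Phi> ` (mbdry A \<times> {0..<\<epsilon>})"
  have MT: "?M \<subseteq> topspace T" by (rule mbdry_subset_topspace[OF A])
  have dA: "d \<in> batlas A" using c' by (simp add: batlas_def d_def)
  have W: "openin T ?W"
    and hom: "homeomorphic_map (prod_topology (subtopology T ?M) (top_of_set {0..<\<epsilon>}))
         (subtopology T ?W) \<Phi>"
    and smF: "smooth_on {(t, y). t \<in> {0..<\<epsilon>} \<and> y \<in> snd d ` fst d \<and> \<Phi> (chart_inv d y, t) \<in> fst c}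
            (\<lambda>(t, y). snd c (\<Phi> (chart_inv d y, t)))"
    and smP: "smooth_on (snd c ` (fst c \<inter> \<Phi> ` (fst d \<times> {0..<\<epsilon>})))
            (\<lambda>z. let (x, t) = inv_into (?M \<times> {0..<\<epsilon>}) \<Phi> (chart_inv c z) in (t, snd d x))"
    and rP: "\<And>x t. x \<in> ?M \<Longrightarrow> t \<in> {0..<\<epsilon>} \<Longrightarrow> r (\<Phi> (x, t)) = t"
    and gradP: "\<And>x t. x \<in> ?M \<Longrightarrow> t \<in> {0..<\<epsilon>} \<Longrightarrow> \<Phi> (x, t) \<in> fst c \<Longrightarrow>
          ((\<lambda>s. snd c (\<Phi> (x, s))) has_vector_derivative gradient gbar r c (\<Phi> (x, t)))
            (at t within {0..<\<epsilon>})"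
    using \<Phi> c dA unfolding product_structure_def Let_def by blast+
  define \<Psi> where "\<Psi> z = (let (x, t) = inv_into (?M \<times> {0..<\<epsilon>}) \<Phi> (chart_inv c z) in (t, snd d x))" for z
  have injP: "inj_on \<Phi> (?M \<times> {0..<\<epsilon>})"
    using homeomorphic_imp_injective_map[OF hom] MT by (simp add: Int_absorb1)
  have SD: "s \<in> {0<..<\<epsilon>}" "s \<in> {0..<\<epsilon>}" "y \<in> snd d ` fst d" "chart_inv d y \<in> fst d"
    "chart_inv d y \<in> ?M" "\<Phi> (chart_inv d y, s) \<in> fst c" if "(s, y) \<in> S" for s y
    using that df(2,4) by (auto simp: S_def collar_dom_def)
  show r_eq: "r (\<Phi> (chart_inv d y, s)) = s" if "(s, y) \<in> S" for s y
    using rP SD[OF that] by blast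
  have bdry: "q \<notin> ?M" if "r q > 0" for q
    using that r by (auto simp: defining_function_def)
  \<comment> \<open>Where \<open>r > 0\<close>, charts take values in the open half space, so relatively open images are open.\<close>
  have nz: "fst (snd c q) \<noteq> 0" if "q \<in> fst c" "r q > 0" for q
    using bdry[OF that(2)] that(1) c by (auto simp: mbdry_def)
  have F_eq: "F (s, y) = snd c (\<Phi> (chart_inv d y, s))" for s y
    by (simp add: F_def collar_map_def)
  show inv: "chart_inv c (F (s, y)) = \<Phi> (chart_inv d y, s)" if "(s, y) \<in> S" for s y
    unfolding F_eq using cf(4) SD(6)[OF that] by blast
  show mint: "\<Phi> (chart_inv d y, s) \<in> fst c \<inter> mint T A" if "(s, y) \<in> S" for s y
    using SD[OF that] cf(1) r_eq[OF that] bdry by (auto simp: mint_def)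
  show "open S"
  proof -
    let ?D = "{0<..<\<epsilon>} \<times> snd d ` fst d"
    have "continuous_map (top_of_set ?D) (subtopology T ?M) (chart_inv d \<circ> snd)"
      by (rule continuous_map_compose[OF _ df(6)])
        (auto simp: continuous_map_in_subtopology intro!: continuous_intros)
    moreover have "continuous_map (top_of_set ?D) (top_of_set {0..<\<epsilon>}) fst"
      by (auto simp: continuous_map_in_subtopology intro!: continuous_intros)
    ultimately have "continuous_map (top_of_set ?D)
        (prod_topology (subtopology T ?M) (top_of_set {0..<\<epsilon>})) (\<lambda>z. (chart_inv d (snd z), fst z))"
      by (simp add: continuous_map_pairwise comp_def)
    from continuous_map_compose[OF this homeomorphic_imp_continuous_map[OF hom]]
    have "continuous_map (top_of_set ?D) T (\<Phi> \<circ> (\<lambda>z. (chart_inv d (snd z), fst z)))"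
      by (simp add: continuous_map_in_subtopology)
    from openin_continuous_map_preimage[OF this cf(2)]
    have "openin (top_of_set ?D) {z \<in> ?D. \<Phi> (chart_inv d (snd z), fst z) \<in> fst c}"
      by simp
    moreover have "{z \<in> ?D. \<Phi> (chart_inv d (snd z), fst z) \<in> fst c} = S"
      by (auto simp: S_def collar_dom_def)
    moreover have "open ?D" using df(1) by (intro open_Times) auto
    ultimately show ?thesis using openin_open_eq by metis
  qed
  show "smooth_on S F"
    unfolding F_def collar_map_def
    by (rule smooth_on_subset[OF smF]) (auto simp: S_def collar_dom_def)
  have FS: "F ` S = snd c ` (fst c \<inter> \<Phi> ` (fst d \<times> {0<..<\<epsilon>}))" (is "_ = snd c ` ?O")
  proof (intro equalityI subsetI)
    fix z assume "z \<in> F ` S"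
    then obtain s y where "(s, y) \<in> S" "z = F (s, y)" by auto
    then show "z \<in> snd c ` ?O" using SD[of s y] F_eq by auto
  next
    fix z assume "z \<in> snd c ` ?O"
    then obtain q s where q: "q \<in> fst d" "s \<in> {0<..<\<epsilon>}" "\<Phi> (q, s) \<in> fst c" "z = snd c (\<Phi> (q, s))" by auto
    then have "(s, snd d q) \<in> S" "F (s, snd d q) = z"
      using df(3)[OF q(1)] by (auto simp: S_def collar_dom_def F_eq)
    then show "z \<in> F ` S" by force
  qed
  show "open (F ` S)"
    unfolding FS
  proof (rule open_chart_image[OF ch])
    have "openin (subtopology T ?M) (fst d)"
      unfolding df(2) using A c' by (auto simp: openin_subtopology smooth_atlas_def is_chart_def)
    moreover have "openin (top_of_set {0..<\<epsilon>}) {0<..<\<epsilon>}"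
      by (auto intro!: openin_open_subtopology[THEN iffD2] open_subset)
    ultimately have "openin (prod_topology (subtopology T ?M) (top_of_set {0..<\<epsilon>})) (fst d \<times> {0<..<\<epsilon>})"
      by (simp add: openin_prod_Times_iff)
    then have "openin (subtopology T ?W) (\<Phi> ` (fst d \<times> {0<..<\<epsilon>}))"
      using homeomorphic_imp_open_map[OF hom] unfolding open_map_def by blast
    then have "openin T (\<Phi> ` (fst d \<times> {0<..<\<epsilon>}))"
      using W openin_trans_full by blast
    then show "openin T ?O" using cf(2) by blast
    show "?O \<subseteq> fst c" by blast
    show "fst (snd c p) \<noteq> 0" if "p \<in> ?O" for p
      using that nz rP df(2) by auto
  qed
  have "smooth_on (F ` S) \<Psi>"
    unfolding FS \<Psi>_def by (rule smooth_on_subset[OF smP]) force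
  moreover have "\<Psi> (F z) = z" if "z \<in> S" for z
  proof -
    obtain s y where z: "z = (s, y)" by (cases z)
    have "inv_into (?M \<times> {0..<\<epsilon>}) \<Phi> (\<Phi> (chart_inv d y, s)) = (chart_inv d y, s)"
      using injP SD[of s y] that z by (intro inv_into_f_f) auto
    then show ?thesis using inv[of s y] df(5)[OF SD(3), of s y] that z by (simp add: \<Psi>_def)
  qed
  ultimately show "\<exists>\<Psi>. smooth_on (F ` S) \<Psi> \<and> (\<forall>z\<in>S. \<Psi> (F z) = z)" by blast
  show "((\<lambda>s. F (s, y)) has_vector_derivative
          gradient gbar r c (\<Phi> (chart_inv d y, s))) (at s)" if "(s, y) \<in> S" for s y
  proof -
    have "at s within {0..<\<epsilon>} = at s"
      using SD(1)[OF that] by (intro at_within_interior) auto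
    then show ?thesis unfolding F_eq using gradP[of "chart_inv d y" s] SD[OF that] by simp
  qed
qed


section \<open>The second fundamental form of the level sets\<close>

text \<open>The value of the second fundamental form: in collar coordinates, applying \<open>-\<L>\<^sub>N / 2\<close> with
  \<open>N = - r \<partial>\<^sub>r\<close> to \<open>r\<^sup>-\<^sup>2 g\<^sub>r\<close> amounts to applying \<open>(r / 2) d/dr\<close>.\<close>

lemma FG_family_radial_derivative:
  assumes "t > 0"
  shows "((\<lambda>s. FG_family \<gamma> P s d x u v / s\<^sup>2) has_real_derivative
    2 / t * ((- \<gamma> d x u v + t ^ 4 / 4 * Q_tensor \<gamma> P d x u v) / t\<^sup>2)) (at t)"
proof -
  have D: "((\<lambda>s. (a - s\<^sup>2 * b + s ^ 4 / 4 * c) / s\<^sup>2) has_real_derivative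
      ((- (2 * t) * b + t ^ 3 * c) * t\<^sup>2 - (a - t\<^sup>2 * b + t ^ 4 / 4 * c) * (2 * t)) / (t\<^sup>2 * t\<^sup>2)) (at t)" for a b c
    using assms by (intro DERIV_divide) (auto intro!: derivative_eq_intros)
  have E: "((- (2 * t) * b + t ^ 3 * c) * t\<^sup>2 - (a - t\<^sup>2 * b + t ^ 4 / 4 * c) * (2 * t)) / (t\<^sup>2 * t\<^sup>2)
      = 2 / t * ((- a + t ^ 4 / 4 * c) / t\<^sup>2)" for a b c
    using assms by (simp add: field_simps eval_nat_numeral)
  show ?thesis
    unfolding FG_family_def E[where b = "P d x u v", symmetric] by (rule D)
qed

text \<open>The tangent spaces of the level sets are identified with the model space of the boundary by
  \<open>L u = DF(0, u)\<close>, where \<open>F\<close> is the collar map. This pulls \<open>g\<close> back to \<open>t\<^sup>-\<^sup>2 g\<^sub>t\<close> and the second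
  fundamental form to \<open>t\<^sup>-\<^sup>2 (- \<gamma> + t\<^sup>4 Q / 4)\<close>.\<close>

lemma second_ff_in_collar:
  fixes A :: "('a, real \<times> 'e::euclidean_space) chart set"
  assumes A: "smooth_atlas halfspace T A" and r: "defining_function T A r"
    and g: "riemannian_metric A (mint T A) g"
    and \<Phi>: "product_structure T A gbar r \<epsilon> \<Phi>"
    and nf: "normal_form T A g \<epsilon> \<Phi> (FG_family \<gamma> P)"
    and c: "c \<in> A" and c': "c' \<in> A" and x: "x \<in> fst c'" "x \<in> mbdry A"
    and t: "0 < t" "t < \<epsilon>" and p: "\<Phi> (x, t) \<in> fst c"
  defines "d \<equiv> bchart A c'"
  obtains L where "linear L" "inj L" "range L = {v. dif c r (\<Phi> (x, t)) v = 0}"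
    and "\<And>u v. g c (\<Phi> (x, t)) (L u) (L v) = FG_family \<gamma> P t d x u v / t\<^sup>2"
    and "\<And>u v. second_ff g (outward_normal gbar r) c (\<Phi> (x, t)) (L u) (L v) =
           (- \<gamma> d x u v + t ^ 4 / 4 * Q_tensor \<gamma> P d x u v) / t\<^sup>2"
proof -
  have ch: "is_chart halfspace T c" using A c by (simp add: smooth_atlas_def)
  note cf = is_chart_facts[OF ch]
  note df = bchart_facts[OF A r c', folded d_def]
  have dA: "d \<in> batlas A" using c' by (simp add: batlas_def d_def)
  define S where "S = collar_dom \<Phi> \<epsilon> c d"
  define F where "F = collar_map \<Phi> c d"
  note collar = collar_coordinates[OF A r \<Phi> c c', folded d_def, folded S_def F_def]
  note S = collar(1) and smF = collar(2) and oFS = collar(3) and inv = collar(5)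
    and mint = collar(6) and r\<Phi> = collar(7) and grad = collar(8)
  obtain \<Psi> where sm\<Psi>: "smooth_on (F ` S) \<Psi>" and \<Psi>: "\<And>z. z \<in> S \<Longrightarrow> \<Psi> (F z) = z"
    using collar(4) by blast
  have rF: "r (chart_inv c (F w)) = fst w" if "w \<in> S" for w
    using that inv r\<Phi> by (cases w) auto
  define y0 where "y0 = snd d x"
  define z where "z = (t, y0)"
  define DF where "DF = (\<lambda>y. frechet_derivative F (at y))"
  have xd: "x \<in> fst d" using x df(2) by blast
  have inv_y0: "chart_inv d y0 = x" unfolding y0_def by (rule df(3)[OF xd])
  have z: "z \<in> S"
    using t p inv_y0 xd by (auto simp: z_def S_def collar_dom_def y0_def)
  have Fz: "F z = snd c (\<Phi> (x, t))" by (simp add: F_def collar_map_def z_def inv_y0)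
  have FzS: "F z \<in> F ` S" using z by blast
  have dF: "(F has_derivative DF w) (at w)" if "w \<in> S" for w
    unfolding DF_def using smooth_on_open_differentiable(1)[OF smF S that] frechet_derivative_works by blast
  have linDF: "linear (DF z)" using has_derivative_linear[OF dF[OF z]] .
  have injDF: "inj (DF z)"
  proof -
    obtain D where D: "(\<Psi> has_derivative D) (at (F z))"
      using smooth_on_open_differentiable(1)[OF sm\<Psi> oFS FzS] unfolding differentiable_def by blast
    have "((\<lambda>w. \<Psi> (F w)) has_derivative (\<lambda>w. D (DF z w))) (at z)"
      by (rule has_derivative_compose[OF dF[OF z] D])
    moreover have "((\<lambda>w. \<Psi> (F w)) has_derivative (\<lambda>w. w)) (at z)"
      by (rule has_derivative_transform_within_open[OF has_derivative_ident S z]) (simp add: \<Psi>)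
    ultimately have "(\<lambda>w. D (DF z w)) = (\<lambda>w. w)" by (rule has_derivative_unique)
    then show ?thesis by (metis injI)
  qed
  then have surjDF: "surj (DF z)" using linDF linear_injective_imp_surjective by blast
  define L where "L u = DF z (0, u)" for u
  have "linear L"
    unfolding L_def by (intro linearI) (simp_all flip: linear_add[OF linDF] linear_scale[OF linDF])
  moreover have "inj L"
    unfolding L_def using injDF by (auto simp: inj_def)
  moreover have "range L = {v. dif c r (\<Phi> (x, t)) v = 0}"
  proof -
    have "smooth_on (snd c ` (fst c \<inter> topspace T)) (r \<circ> chart_inv c)"
      using r c by (simp add: defining_function_def smooth_fun_def)
    moreover have FSc: "F ` S \<subseteq> snd c ` fst c"
      by (auto simp: F_def S_def collar_map_def collar_dom_def)
    moreover have "fst c \<inter> topspace T = fst c" using cf(1) by blast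
    ultimately have "smooth_on (F ` S) (r \<circ> chart_inv c)"
      by (auto intro: smooth_on_subset)
    then obtain D where D: "((r \<circ> chart_inv c) has_derivative D) (at (F z))"
      using smooth_on_open_differentiable(1)[OF _ oFS FzS] unfolding differentiable_def by blast
    have "at (F z) within snd c ` fst c = at (F z)"
      by (rule at_within_interior) (meson FSc FzS interiorI oFS)
    then have dif: "dif c r (\<Phi> (x, t)) = D"
      unfolding dif_def Fz[symmetric] using frechet_derivative_at[OF D] by simp
    have "((\<lambda>w. (r \<circ> chart_inv c) (F w)) has_derivative (\<lambda>w. D (DF z w))) (at z)"
      by (rule has_derivative_compose[OF dF[OF z] D])
    moreover have "((\<lambda>w. (r \<circ> chart_inv c) (F w)) has_derivative fst) (at z)"
      by (rule has_derivative_transform_within_open[OF has_derivative_fst[OF has_derivative_ident] S z])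
        (simp add: rF)
    ultimately have "(\<lambda>w. D (DF z w)) = fst" by (rule has_derivative_unique)
    then have DDF: "D (DF z w) = fst w" for w by (rule fun_cong)
    show ?thesis
    proof (intro equalityI subsetI)
      fix v assume "v \<in> range L"
      then show "v \<in> {v. dif c r (\<Phi> (x, t)) v = 0}" by (auto simp: dif L_def DDF)
    next
      fix v assume "v \<in> {v. dif c r (\<Phi> (x, t)) v = 0}"
      moreover obtain a u where "v = DF z (a, u)" using surjDF by (metis surjD surj_pair)
      ultimately show "v \<in> range L" by (auto simp: dif L_def DDF)
    qed
  qed
  moreover have gF: "g c (\<Phi> (x, s)) (DF (s, y0) (0, u)) (DF (s, y0) (0, v)) = FG_family \<gamma> P s d x u v / s\<^sup>2"
    if "(s, y0) \<in> S" for s u v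
  proof -
    have "s \<in> {0<..<\<epsilon>}" "\<Phi> (x, s) \<in> fst c"
      using that inv_y0 by (auto simp: S_def collar_dom_def)
    moreover have "((\<lambda>(s, y). snd c (\<Phi> (chart_inv d y, s))) has_derivative DF (s, y0))
          (at (s, snd d x) within {0<..<\<epsilon>} \<times> snd d ` fst d)"
      using has_derivative_at_withinI[OF dF[OF that]] unfolding F_def collar_map_def y0_def .
    ultimately have "\<forall>a b u v. g c (\<Phi> (x, s)) (DF (s, y0) (a, u)) (DF (s, y0) (b, v)) =
        (a * b + FG_family \<gamma> P s d x u v) / s\<^sup>2"
      using nf[unfolded normal_form_def, rule_format, OF c dA xd] by blast
    then show ?thesis by simp
  qed
  then have "g c (\<Phi> (x, t)) (L u) (L v) = FG_family \<gamma> P t d x u v / t\<^sup>2" for u v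
    using z unfolding L_def z_def by blast
  moreover have "second_ff g (outward_normal gbar r) c (\<Phi> (x, t)) (L u) (L v) =
           (- \<gamma> d x u v + t ^ 4 / 4 * Q_tensor \<gamma> P d x u v) / t\<^sup>2" for u v
  proof -
    define N where "N w = outward_normal gbar r c (chart_inv c w)" for w
    define G where "G = coord_rep c g"
    have DF_e: "DF (s, y) (1, 0) = gradient gbar r c (\<Phi> (chart_inv d y, s))" if "(s, y) \<in> S" for s y
    proof -
      have "((\<lambda>s. (s, y)) has_derivative (\<lambda>k. (k, 0))) (at s)"
        by (auto intro!: derivative_eq_intros)
      from has_derivative_compose[OF this dF[OF that]]
      have "((\<lambda>s. F (s, y)) has_derivative (\<lambda>k. DF (s, y) (k, 0))) (at s)" .
      from fun_cong[OF has_derivative_unique[OF this grad[OF that, unfolded has_vector_derivative_def]], of 1]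
      show ?thesis by simp
    qed
    have NF: "N (F w) = - fst w *\<^sub>R DF w (1, 0)" if "w \<in> S" for w
      using that by (cases w) (simp add: N_def outward_normal_def inv r\<Phi> DF_e)
    have tens: "tensor2_on A (mint T A) g"
      using g by (simp add: riemannian_metric_def sym_tensor2_on_def)
    have FS: "chart_inv c w \<in> fst c \<inter> mint T A" "w \<in> snd c ` (fst c \<inter> mint T A)" if w: "w \<in> F ` S" for w
    proof -
      obtain s y where sy: "(s, y) \<in> S" "w = F (s, y)" using w by (metis imageE surj_pair)
      show "chart_inv c w \<in> fst c \<inter> mint T A" using inv mint sy by metis
      have "w = snd c (\<Phi> (chart_inv d y, s))" using sy by (simp add: F_def collar_map_def)
      then show "w \<in> snd c ` (fst c \<inter> mint T A)" using mint[OF sy(1)] by blast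
    qed
    have bil: "bilinear (G w)" if "w \<in> F ` S" for w
      using tens c FS(1)[OF that] unfolding G_def coord_rep_def tensor2_on_def by blast
    have Gd: "(\<lambda>w. G w a b) differentiable (at (F z))" for a b
    proof -
      have "smooth_on (snd c ` (fst c \<inter> mint T A)) (\<lambda>w. g c (chart_inv c w) a b)"
        using tens c unfolding tensor2_on_def by blast
      then have "smooth_on (F ` S) (\<lambda>w. G w a b)"
        unfolding G_def coord_rep_def by (rule smooth_on_subset) (use FS(2) in blast)
      then show ?thesis by (rule smooth_on_open_differentiable(1)[OF _ oFS FzS])
    qed
    have DFd: "(\<lambda>w. DF w b) differentiable (at z)" for b
      unfolding DF_def by (rule smooth_on_open_differentiable(2)[OF smF S z])
    \<comment> \<open>On the manifold side \<open>N\<close> is known only through \<open>NF\<close>; the smooth inverse \<open>\<Psi>\<close> gives its regularity.\<close>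
    have Nd: "N differentiable (at (F z))"
    proof -
      have "\<Psi> differentiable (at (F z))"
        by (rule smooth_on_open_differentiable(1)[OF sm\<Psi> oFS FzS])
      then obtain \<Psi>' where \<Psi>': "(\<Psi> has_derivative \<Psi>') (at (F z))" unfolding differentiable_def by blast
      obtain E where E: "((\<lambda>w. DF w (1, 0)) has_derivative E) (at (\<Psi> (F z)))"
        using DFd \<Psi>[OF z] unfolding differentiable_def by metis
      have "((\<lambda>w. - fst (\<Psi> w) *\<^sub>R DF (\<Psi> w) (1, 0)) has_derivative
          (\<lambda>h. - fst (\<Psi> (F z)) *\<^sub>R E (\<Psi>' h) + (- fst (\<Psi>' h)) *\<^sub>R DF (\<Psi> (F z)) (1, 0))) (at (F z))"
        by (intro has_derivative_scaleR has_derivative_minus has_derivative_fst \<Psi>'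
            has_derivative_compose[OF \<Psi>' E])
      then have "(\<lambda>w. - fst (\<Psi> w) *\<^sub>R DF (\<Psi> w) (1, 0)) differentiable (at (F z))"
        unfolding differentiable_def by blast
      then show ?thesis
        by (rule differentiable_transform_within_open[OF _ oFS FzS]) (auto simp: \<Psi> NF)
    qed
    have \<phi>: "((\<lambda>w. - fst w) has_derivative (\<lambda>w::real \<times> 'e. - fst w)) (at z)"
      by (intro has_derivative_minus has_derivative_fst has_derivative_ident)
    \<comment> \<open>\<open>N\<close> corresponds to \<open>- s \<partial>\<^sub>s\<close>, whose coefficient is constant along the vectors \<open>(0, u)\<close>.\<close>
    obtain q' where q': "((\<lambda>w. G (F w) (DF w (0, u)) (DF w (0, v))) has_derivative q') (at z)"
      and lie: "lie_derivative N G (F z) (DF z (0, u)) (DF z (0, v)) = - fst z * q' (1, 0)"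
      unfolding DF_def
      by (rule lie_derivative_pullback[OF S z oFS imageI bil Gd smooth_on_open_differentiable(1)[OF smF S]
            DFd[unfolded DF_def] Nd NF[unfolded DF_def] \<phi>, of "(0, u)" "(0, v)"]) auto
    define f where "f s = FG_family \<gamma> P s d x u v / s\<^sup>2" for s
    have "((\<lambda>s. (s, y0)) has_derivative (\<lambda>k. (k, 0))) (at t)"
      by (auto intro!: derivative_eq_intros)
    from has_derivative_compose[OF this, folded z_def, OF q']
    have "((\<lambda>s. G (F (s, y0)) (DF (s, y0) (0, u)) (DF (s, y0) (0, v))) has_derivative
        (\<lambda>k. q' (k, 0))) (at t)" .
    moreover have "open ((\<lambda>s. (s, y0)) -` S)" by (intro open_vimage S continuous_intros)
    moreover have "t \<in> (\<lambda>s. (s, y0)) -` S" using z by (simp add: z_def)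
    ultimately have "(f has_derivative (\<lambda>k. q' (k, 0))) (at t)"
      by (rule has_derivative_transform_within_open)
        (simp add: f_def G_def coord_rep_def inv inv_y0 gF)
    moreover have "(f has_real_derivative
        2 / t * ((- \<gamma> d x u v + t ^ 4 / 4 * Q_tensor \<gamma> P d x u v) / t\<^sup>2)) (at t)"
      unfolding f_def by (rule FG_family_radial_derivative[OF t(1)])
    ultimately have "q' (1, 0) = 2 / t * ((- \<gamma> d x u v + t ^ 4 / 4 * Q_tensor \<gamma> P d x u v) / t\<^sup>2)"
      using has_derivative_unique unfolding has_field_derivative_def by (metis mult.right_neutral)
    moreover have "second_ff g (outward_normal gbar r) c (\<Phi> (x, t)) (L u) (L v) = t / 2 * q' (1, 0)"
      unfolding second_ff_def Fz[symmetric] L_def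
      using lie by (simp add: N_def[abs_def] G_def z_def)
    moreover have "t / 2 * (2 / t * k) = k" for k using t(1) by simp
    ultimately show ?thesis by metis
  qed
  ultimately show ?thesis by (rule that)
qed


section \<open>Principal curvatures and eigenvalues\<close>

theorem theorem1p1:
  fixes T :: "'a topology"
    and A :: "('a, real \<times> 'e::euclidean_space) chart set"
    and g gbar :: "('a, real \<times> 'e) tensor2"
    and \<gamma> P :: "('a, 'e) tensor2"
    and r :: "'a \<Rightarrow> real" and \<epsilon> t :: real and \<Phi> :: "'a \<times> real \<Rightarrow> 'a"
    and x :: 'a and eigs :: "nat \<Rightarrow> real"
  assumes "DIM('e) \<ge> 2"
    and "hyperbolic_poincare T A g"
    and "\<gamma> \<in> conformal_infinity T A g"
    and "geodesic_defining_function T A g \<gamma> r gbar"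
    and "product_structure T A gbar r \<epsilon> \<Phi>"
    and "FG_expansion T A g \<gamma> \<epsilon> \<Phi> P"
    and "x \<in> mbdry A" and "0 < t" and "t < \<epsilon>"
    and "tensor_eigenvalues (batlas A) \<gamma> P x eigs"
  shows "\<exists>\<kappa>. outward_principal_curvatures A g gbar r (\<Phi> (x, t)) \<kappa> \<and>
    (\<forall>i\<in>{1..DIM('e)}. \<kappa> i \<noteq> 1 \<and> 1 - t\<^sup>2 / 2 * eigs i = 2 / (1 - \<kappa> i))"
proof -
  have A: "smooth_atlas halfspace T A" and g: "riemannian_metric A (mint T A) g"
    using assms(2) by (auto simp: hyperbolic_poincare_def compact_manifold_with_boundary_def
        conformally_compact_def)
  have r: "defining_function T A r"
    using assms(4) by (simp add: geodesic_defining_function_def compactification_def)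
  have nf: "normal_form T A g \<epsilon> \<Phi> (FG_family \<gamma> P)"
    and P: "sym_tensor2_on (batlas A) (mbdry A) P"
    using assms(6) by (auto simp: FG_expansion_def)
  have \<gamma>: "riemannian_metric (batlas A) (mbdry A) \<gamma>"
    using assms(3) by (simp add: conformal_infinity_def)
  obtain c' where c': "c' \<in> A" "x \<in> fst c'" using assms(7) by (auto simp: mbdry_def)
  define d where "d = bchart A c'"
  have d: "d \<in> batlas A" "x \<in> fst d \<inter> mbdry A"
    using c' assms(7) by (auto simp: d_def batlas_def bchart_def)
  have \<gamma>d: "bilinear (\<gamma> d x)" "\<And>u v. \<gamma> d x u v = \<gamma> d x v u" "\<And>u. u \<noteq> 0 \<Longrightarrow> \<gamma> d x u u > 0"
    using \<gamma> d unfolding riemannian_metric_def sym_tensor2_on_def tensor2_on_def by blast+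
  have Pd: "bilinear (P d x)" "\<And>u v. P d x u v = P d x v u"
    using P d unfolding sym_tensor2_on_def tensor2_on_def by blast+
  have eigs: "eigenvalues_of DIM('e) UNIV (\<gamma> d x) (P d x) eigs"
    using assms(10) d by (simp add: tensor_eigenvalues_def)
  let ?p = "\<Phi> (x, t)"
  let ?h = "\<lambda>u v. FG_family \<gamma> P t d x u v / t\<^sup>2"
  let ?K = "\<lambda>u v. (- \<gamma> d x u v + t ^ 4 / 4 * Q_tensor \<gamma> P d x u v) / t\<^sup>2"
  note collar = second_ff_in_collar[OF A r g assms(5) nf _ c'(1) c'(2) assms(7-9), folded d_def]
  have pT: "?p \<in> topspace T" and rp: "r ?p = t"
  proof -
    let ?W = "\<Phi> ` (mbdry A \<times> {0..<\<epsilon>})"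
    have "openin T ?W" and "\<forall>x\<in>mbdry A. \<forall>t\<in>{0..<\<epsilon>}. r (\<Phi> (x, t)) = t"
      using assms(5) unfolding product_structure_def Let_def by blast+
    then show "?p \<in> topspace T" "r ?p = t"
      using assms(7-9) openin_subset[of T ?W] by auto
  qed
  have "?p \<in> mint T A"
    using pT rp r assms(8) by (auto simp: mint_def defining_function_def)
  \<comment> \<open>Definiteness of \<open>g\<^sub>t\<close> comes from that of \<open>g\<close>, as \<open>L\<close> is injective.\<close>
  have pos: "?h u u > 0" if u: "u \<noteq> 0" for u
  proof -
    obtain c where c: "c \<in> A" "?p \<in> fst c" 
    proof -
      have "?p \<in> (\<Union>c\<in>A. fst c)" using A pT by (simp add: smooth_atlas_def)
      then show ?thesis using that by blast
    qed
    obtain L where L: "linear L" "inj L"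
      and gL: "\<And>u v. g c ?p (L u) (L v) = FG_family \<gamma> P t d x u v / t\<^sup>2"
      using collar[OF c] by metis
    have "L u \<noteq> 0" using L u by (metis injD linear_0)
    then show ?thesis
      using g c \<open>?p \<in> mint T A\<close> unfolding riemannian_metric_def gL[symmetric] by blast
  qed
  define \<kappa> where "\<kappa> i = 1 - 2 / (1 - t\<^sup>2 / 2 * eigs i)" for i
  have pos': "(\<gamma> d x u u - t\<^sup>2 * P d x u u + t ^ 4 / 4 * P d x u (raise (\<gamma> d x) (P d x u))) / t\<^sup>2 > 0"
    if "u \<noteq> 0" for u
    using pos[OF that] unfolding FG_family_def Q_tensor_def .
  have ne: "1 - t\<^sup>2 / 2 * eigs i \<noteq> 0" if "i \<in> {1..DIM('e)}" for i
    by (rule FG_eigenvalues(1)[OF \<gamma>d(1,2) _ Pd assms(8) _ eigs that]) (fact \<gamma>d(3), fact pos')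
  have \<kappa>: "eigenvalues_of DIM('e) UNIV ?h ?K \<kappa>"
    unfolding \<kappa>_def FG_family_def Q_tensor_def
    by (rule FG_eigenvalues(2)[OF \<gamma>d(1,2) _ Pd assms(8) _ eigs]) (fact \<gamma>d(3), fact pos')
  have "outward_principal_curvatures A g gbar r ?p \<kappa>"
    unfolding outward_principal_curvatures_def
  proof (intro ballI impI)
    fix c assume c: "c \<in> A" "?p \<in> fst c"
    obtain L where L: "linear L" "inj L" "range L = {v. dif c r ?p v = 0}"
      and gL: "\<And>u v. g c ?p (L u) (L v) = ?h u v"
      and KL: "\<And>u v. second_ff g (outward_normal gbar r) c ?p (L u) (L v) = ?K u v"
      using collar[OF c] by metis
    show "eigenvalues_of DIM('e) {v. dif c r ?p v = 0} (g c ?p)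
        (second_ff g (outward_normal gbar r) c ?p) \<kappa>"
      by (rule eigenvalues_of_linear_image[OF L(1,2) L(3)[symmetric] gL KL \<kappa>])
  qed
  moreover have "\<kappa> i \<noteq> 1 \<and> 1 - t\<^sup>2 / 2 * eigs i = 2 / (1 - \<kappa> i)" if "i \<in> {1..DIM('e)}" for i
    using ne[OF that] by (simp add: \<kappa>_def)
  ultimately show ?thesis by blast
qed

end
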